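(* Let $\lambda,\mu\in\mathbb C$, $0\le k\le n$ and $m\in\mathbb N$, $m\ge1$. The operators $B^{(m)}_{k;\lambda,\mu}=\widetilde\Psi^{(k)}\circ E_{\lambda+m-1,\mu+m-1}\circ\cdots\circ E_{\lambda,\mu}$ (with $B^{(0)}_{k;\lambda,\mu}=\widetilde\Psi^{(k)}$) from $C^\infty(\mathbb R^n\times\mathbb R^n,\mathbb S\otimes\mathbb S')$ to $C^\infty(\mathbb R^n,\Lambda_k^*(\mathbb R^n)\otimes\mathbb C)$ satisfy the recurrence relation $$B^{(m)}_{k;\lambda,\mu}=B^{(m-1)}_{k;\lambda+1,\mu+1}\circ E_{\lambda,\mu}.$$
   Context: Let $n\ge 1$, $e_1,\dots,e_n$ the standard basis of Euclidean $\mathbb R^n$, and $C\ell(\mathbb R^n)$ the real unital algebra generated by $\mathbb R^n$ with $xy+yx=-2\langle x,y\rangle$. Let $\mathbb S$ be a finite-dimensional complex vector space with a unital algebra homomorphism $\rho\colon C\ell(\mathbb R^n)\otimes\mathbb C\to\mathrm{End}(\mathbb S)$. On the dual $\mathbb S'$ (pairing $(s,t')$), $\rho'(x)t'=-t'\circ\rho(x)$ for $x\in\mathbb R^n$, extended to an algebra homomorphism. $\mathbf D=\sum_j\rho(e_j)\partial_j$, $\mathbf D'=\sum_j\rho'(e_j)\partial_j$, $\Delta=\sum_j\partial_j^2$; subscripts $x,y$ indicate the variable. In $P\otimes P'$, $P$ acts in $x$ and on $\mathbb S$, $P'$ in $y$ and on $\mathbb S'$; coefficients depending on $x,y$ act by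 multiplication after the derivatives. The source operator on $C^\infty(\mathbb R^n\times\mathbb R^n,\mathbb S\otimes\mathbb S')$ is (sums over $1\le j\le n$) $$\begin{aligned}E_{\lambda,\mu}={}&|x-y|^2\Delta_x\otimes\Delta_y+2(2\lambda-n+1)\sum_{j}(x_j-y_j)\tfrac{\partial}{\partial x_j}\otimes\Delta_y+2(2\mu-n+1)\sum_{j}(y_j-x_j)\Delta_x\otimes\tfrac{\partial}{\partial y_j}\\&-2\rho(x-y)\mathbf D_x\otimes\Delta_y-2\Delta_x\otimes\rho'(y-x)\mathbf D'_y+(2\mu-n+1)(2\mu+1)\Delta_x\otimes\mathrm{id}+(2\lambda-n+1)(2\lambda+1)\,\mathrm{id}\otimes\Delta_y\\&-2(2\lambda-n+1)(2\mu-n+1)\sum_{j}\tfrac{\partial}{\partial x_j}\otimes\tfrac{\partial}{\partial y_j}+2(2\lambda-n+1)\sum_{j}\tfrac{\partial}{\partial x_j}\otimes\rho'(e_j)\mathbf D'_y\\&+2(2\mu-n+1)\sum_{j}\rho(e_j)\mathbf D_x\otimes\tfrac{\partial}{\partial y_j}-2\sum_{j}\rho(e_j)\mathbf D_x\otimes\rho'(e_j)\mathbf D'_y.\end{aligned}$$ $\Lambda^*_k(\mathbb R^n)$ is the space of alternating $k$-forms, i.e. the dual of $\Lambda^k(\mathbb R^n)$. $\Psi^{(k)}\colon\mathbb S\otimes\mathbb S'\to\Lambda^*_k(\mathbb R^n)\otimes\mathbb C$ is given by $\Psi^{(k)}(s\otimes t')(e_{i_1}\wedge\cdots\wedge e_{i_k})=(\rho(e_{i_1})\cdots\rho(e_{i_k})s,t')$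 for $i_1<\dots<i_k$ (and $\Psi^{(0)}(s\otimes t')=(s,t')$), and $(\widetilde\Psi^{(k)}F)(x)=\Psi^{(k)}(F(x,x))$. *)

theory Defs
  imports "HOL-Analysis.Analysis"
begin

section \<open>Complex vector spaces\<close>

class complex_vector = real_vector +
  fixes scaleC :: "complex \<Rightarrow> 'a \<Rightarrow> 'a" (infixr "*\<^sub>C" 75)
  assumes scaleC_add_right: "a *\<^sub>C (x + y) = a *\<^sub>C x + a *\<^sub>C y"
    and scaleC_add_left: "(a + b) *\<^sub>C x = a *\<^sub>C x + b *\<^sub>C x"
    and scaleC_scaleC: "a *\<^sub>C (b *\<^sub>C x) = (a * b) *\<^sub>C x"
    and scaleC_of_real: "complex_of_real r *\<^sub>C x = r *\<^sub>R x"

instantiation complex :: complex_vector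
begin
definition "scaleC (a :: complex) (x :: complex) = a * x"
instance
  by standard (simp_all add: scaleC_complex_def algebra_simps scaleR_conv_of_real)
end

lemma vector_space_scaleC: "vector_space (scaleC :: complex \<Rightarrow> 'a \<Rightarrow> 'a::complex_vector)"
proof
  fix x :: 'a
  show "1 *\<^sub>C x = x"
    using scaleC_of_real[of 1 x] by simp
qed (simp_all add: scaleC_add_right scaleC_add_left scaleC_scaleC)

definition finite_dim :: "'a::complex_vector itself \<Rightarrow> bool" where
  "finite_dim _ \<longleftrightarrow>
    (\<exists>B. finite_dimensional_vector_space (scaleC :: complex \<Rightarrow> 'a \<Rightarrow> 'a) B)"

definition clinear :: "('a::complex_vector \<Rightarrow> 'b::complex_vector) \<Rightarrow> bool" where
  "clinear f \<longleftrightarrow> Vector_Spaces.linear scaleC scaleC f"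

text \<open>The dual space, with pairing \<open>(s, t) = t s\<close>.\<close>

definition dual :: "('a::complex_vector \<Rightarrow> complex) set" where
  "dual = {t. clinear t}"


section \<open>The tensor product of a space with its dual\<close>

definition bilinear_dual :: "('s::complex_vector \<Rightarrow> ('s \<Rightarrow> complex) \<Rightarrow> 'w::complex_vector) \<Rightarrow> bool"
  where
  "bilinear_dual \<beta> \<longleftrightarrow>
    (\<forall>t\<in>dual. clinear (\<lambda>s. \<beta> s t)) \<and>
    (\<forall>s. \<forall>t\<in>dual. \<forall>u\<in>dual. \<beta> s (\<lambda>v. t v + u v) = \<beta> s t + \<beta> s u) \<and>
    (\<forall>s c. \<forall>t\<in>dual. \<beta> s (\<lambda>v. c * t v) = c *\<^sub>C \<beta> s t)"

text \<open>
  The type \<open>'t\<close> together with \<open>tens s t\<close>, read \<open>s \<otimes> t\<close>, is a tensor product of \<open>'s\<close> and its dual.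
  Only scalar-valued bilinear maps are tested: over a field this already implies the universal
  property for bilinear maps into arbitrary vector spaces.
\<close>

definition is_tensor_product ::
    "('s::complex_vector \<Rightarrow> ('s \<Rightarrow> complex) \<Rightarrow> 't::complex_vector) \<Rightarrow> bool" where
  "is_tensor_product tens \<longleftrightarrow>
    bilinear_dual tens \<and>
    (\<forall>\<beta> :: 's \<Rightarrow> ('s \<Rightarrow> complex) \<Rightarrow> complex. bilinear_dual \<beta> \<longrightarrow>
      (\<exists>!\<phi>. clinear \<phi> \<and> (\<forall>s. \<forall>t\<in>dual. \<phi> (tens s t) = \<beta> s t)))"

definition tensor_lift ::
    "('s::complex_vector \<Rightarrow> ('s \<Rightarrow> complex) \<Rightarrow> 't::complex_vector) \<Rightarrow>
     ('s \<Rightarrow> ('s \<Rightarrow> complex) \<Rightarrow> 'w::complex_vector) \<Rightarrow> 't \<Rightarrow> 'w" where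
  "tensor_lift tens \<beta> =
    (THE \<phi>. clinear \<phi> \<and> (\<forall>s. \<forall>t\<in>dual. \<phi> (tens s t) = \<beta> s t))"


section \<open>The Clifford algebra\<close>

text \<open>
  The Clifford algebra in its standard basis \<open>e\<^sub>I = e\<^sub>i\<^sub>1 \<cdots> e\<^sub>i\<^sub>k\<close> for \<open>I = {i\<^sub>1 < \<cdots> < i\<^sub>k}\<close>, where
  \<open>e\<^sub>I = axis I 1\<close>. Real coefficients give the Clifford algebra of Euclidean space, complex
  coefficients its complexification. Sorting the product \<open>e\<^sub>I e\<^sub>J\<close> costs one sign for every
  transposition of \<open>e\<^sub>i e\<^sub>j\<close> with \<open>j < i\<close>, and one for every square \<open>e\<^sub>i e\<^sub>i = - 1\<close>.
  The lemmas \<open>cl_mult_assoc\<close>, \<open>cl_relation\<close> and \<open>cl_axis_eq_product\<close> below, with the dimension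
  \<open>2\<^sup>n\<close>, identify this model with the algebra given by generators and relations.
\<close>

definition cl_sign :: "'n::linorder set \<Rightarrow> 'n set \<Rightarrow> 'a::comm_ring_1" where
  "cl_sign I J = (\<Prod>i\<in>I. \<Prod>j\<in>J. if j \<le> i then - 1 else 1)"

definition cl_one :: "'a::comm_ring_1 ^ ('n::{finite,linorder} set)" where
  "cl_one = axis {} 1"

definition cl_mult :: "'a::comm_ring_1 ^ ('n::{finite,linorder} set) \<Rightarrow> 'a ^ ('n set) \<Rightarrow> 'a ^ ('n set)"
  where
  "cl_mult a b = (\<Sum>I\<in>UNIV. \<Sum>J\<in>UNIV. (a $ I * b $ J * cl_sign I J) *s axis (sym_diff I J) 1)"

definition cl_vec :: "real ^ 'n::{finite,linorder} \<Rightarrow> complex ^ ('n::{finite,linorder} set)" where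
  "cl_vec x = (\<Sum>j\<in>UNIV. complex_of_real (x $ j) *s axis {j} 1)"

lemma cl_mult_nth:
  "cl_mult a b $ K = (\<Sum>I\<in>UNIV. a $ I * b $ (sym_diff I K) * cl_sign I (sym_diff I K))"
proof -
  have eq: "K = sym_diff I J \<longleftrightarrow> sym_diff I K = J" for I J
    by blast
  have "cl_mult a b $ K = (\<Sum>I\<in>UNIV. \<Sum>J\<in>UNIV. if sym_diff I K = J then a $ I * b $ J * cl_sign I J else 0)"
    unfolding cl_mult_def sum_component
    by (intro sum.cong refl) (simp add: axis_def eq)
  then show ?thesis
    by simp
qed

lemma prod_sign_sym_diff:
  fixes f :: "'b \<Rightarrow> 'a::comm_ring_1"
  assumes "finite A" "finite B" "\<And>x. f x * f x = 1"
  shows "prod f (sym_diff A B) = prod f A * prod f B"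
proof -
  let ?P = "prod f (A - B)" and ?Q = "prod f (B - A)" and ?R = "prod f (A \<inter> B)"
  have A: "prod f A = ?P * ?R"
    using assms(1,2) by (subst prod.union_disjoint[symmetric]) (auto intro: arg_cong2[where f = prod])
  have B: "prod f B = ?Q * ?R"
    using assms(1,2) by (subst prod.union_disjoint[symmetric]) (auto intro: arg_cong2[where f = prod])
  have R: "?R * ?R = 1"
    using assms(3) by (simp flip: prod.distrib)
  have "prod f A * prod f B = (?P * ?Q) * (?R * ?R)"
    unfolding A B by (simp only: mult_ac)
  also have "\<dots> = prod f (sym_diff A B)"
    unfolding R using assms(1,2) by (subst prod.union_disjoint) auto
  finally show ?thesis by simp
qed

lemma cl_sign_sym_diff_left:
  "cl_sign (sym_diff I J) (K :: 'n::{finite,linorder} set) = (cl_sign I K * cl_sign J K :: 'a::comm_ring_1)"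
  unfolding cl_sign_def
  by (rule prod_sign_sym_diff) (auto simp flip: prod.distrib intro: prod.neutral)

lemma cl_sign_sym_diff_right:
  "cl_sign K (sym_diff I (J :: 'n::{finite,linorder} set)) = (cl_sign K I * cl_sign K J :: 'a::comm_ring_1)"
  unfolding cl_sign_def
  by (simp flip: prod.distrib, intro prod.cong refl, rule prod_sign_sym_diff) auto

lemma cl_mult_assoc: "cl_mult (cl_mult a b) c = cl_mult a (cl_mult b c)"
proof (subst vec_eq_iff, rule allI)
  fix L :: "'b set"
  let ?s = "cl_sign :: 'b set \<Rightarrow> 'b set \<Rightarrow> 'a"
  have "cl_mult (cl_mult a b) c $ L =
      (\<Sum>K\<in>UNIV. \<Sum>I\<in>UNIV. a $ I * b $ (sym_diff I K) * ?s I (sym_diff I K) * c $ (sym_diff K L) * ?s K (sym_diff K L))"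
    by (simp add: cl_mult_nth sum_distrib_right)
  also have "\<dots> = (\<Sum>I\<in>UNIV. \<Sum>K\<in>UNIV. a $ I * b $ (sym_diff I K) * ?s I (sym_diff I K) * c $ (sym_diff K L) * ?s K (sym_diff K L))"
    by (rule sum.swap)
  also have "\<dots> = (\<Sum>I\<in>UNIV. \<Sum>J\<in>UNIV. a $ I * (b $ J * c $ (sym_diff J (sym_diff I L)) * ?s J (sym_diff J (sym_diff I L))) * ?s I (sym_diff I L))"
  proof (rule sum.cong[OF refl])
    fix I :: "'b set"
    show "(\<Sum>K\<in>UNIV. a $ I * b $ (sym_diff I K) * ?s I (sym_diff I K) * c $ (sym_diff K L) * ?s K (sym_diff K L))
      = (\<Sum>J\<in>UNIV. a $ I * (b $ J * c $ (sym_diff J (sym_diff I L)) * ?s J (sym_diff J (sym_diff I L))) * ?s I (sym_diff I L))"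
    proof (rule sum.reindex_bij_witness[where i = "\<lambda>J. sym_diff I J" and j = "\<lambda>K. sym_diff I K"])
      fix K :: "'b set"
      show "sym_diff I (sym_diff I K) = K" "sym_diff I (sym_diff I K) = K" by blast+
      define J where "J = sym_diff I K"
      define M where "M = sym_diff K L"
      have K: "K = sym_diff I J" and M: "sym_diff J (sym_diff I L) = M" and L: "sym_diff I L = sym_diff J M"
        unfolding J_def M_def by blast+
      have JM: "sym_diff J (sym_diff J M) = M"
        by blast
      have s: "?s I J * ?s K M = ?s J M * ?s I (sym_diff J M)"
        unfolding K cl_sign_sym_diff_left cl_sign_sym_diff_right by (simp add: mult_ac)
      have "a $ I * (b $ J * c $ M * ?s J M) * ?s I (sym_diff J M)
          = (a $ I * b $ J * c $ M) * (?s J M * ?s I (sym_diff J M))"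
        by (simp only: mult_ac)
      also have "\<dots> = a $ I * b $ J * ?s I J * c $ M * ?s K M"
        unfolding s[symmetric] by (simp only: mult_ac)
      finally show "a $ I * (b $ sym_diff I K * c $ (sym_diff (sym_diff I K) (sym_diff I L)) * ?s (sym_diff I K) (sym_diff (sym_diff I K) (sym_diff I L))) * ?s I (sym_diff I L)
         = a $ I * b $ (sym_diff I K) * ?s I (sym_diff I K) * c $ (sym_diff K L) * ?s K (sym_diff K L)"
        unfolding J_def[symmetric] M_def[symmetric] L JM .
    qed auto
  qed
  also have "\<dots> = cl_mult a (cl_mult b c) $ L"
    by (simp add: cl_mult_nth sum_distrib_left sum_distrib_right)
  finally show "cl_mult (cl_mult a b) c $ L = cl_mult a (cl_mult b c) $ L" .
qed

lemma sum_axis_mult: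
  "(\<Sum>I\<in>UNIV. axis A 1 $ I * f I) = (f A :: 'a::comm_ring_1)" for A :: "'b::finite"
proof -
  have "(\<Sum>I\<in>UNIV. axis A 1 $ I * f I) = (\<Sum>I\<in>UNIV. if I = A then f I else 0)"
    by (intro sum.cong refl) (simp add: axis_def)
  then show ?thesis by simp
qed

lemma cl_mult_axis_nth:
  "cl_mult (axis I 1) b $ K = b $ (sym_diff I K) * (cl_sign I (sym_diff I K) :: 'a::comm_ring_1)"
  by (simp only: cl_mult_nth mult.assoc sum_axis_mult)

lemma cl_mult_axis:
  "cl_mult (axis I 1) (axis J 1) = cl_sign I J *s axis (sym_diff I J) (1 :: 'a::comm_ring_1)"
proof -
  have "K = sym_diff I J \<longleftrightarrow> sym_diff I K = J" for K
    by blast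
  then show ?thesis
    by (simp add: vec_eq_iff cl_mult_axis_nth) (simp add: axis_def)
qed

lemma cl_one_left: "cl_mult cl_one a = a"
  by (simp add: vec_eq_iff cl_one_def cl_mult_axis_nth cl_sign_def)

lemma cl_one_right: "cl_mult a cl_one = a"
proof -
  have eq: "sym_diff I K = {} \<longleftrightarrow> I = K" for I K :: "'b set"
    by blast
  have "cl_mult a cl_one $ K = (\<Sum>I\<in>UNIV. if I = K then a $ I else 0)" for K
    unfolding cl_mult_nth cl_one_def axis_def vec_lambda_beta eq
    by (intro sum.cong refl) (auto simp: cl_sign_def)
  then show ?thesis
    by (simp add: vec_eq_iff)
qed

lemma cl_axis_eq_product:
  "foldr cl_mult (map (\<lambda>i. axis {i} 1) (sorted_list_of_set I)) cl_one = axis I (1 :: 'a::comm_ring_1)"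
proof -
  have "foldr cl_mult (map (\<lambda>i. axis {i} 1) is) cl_one = axis (set is) (1 :: 'a)"
    if "sorted_wrt (<) is" for "is" :: "'b list"
    using that
  proof (induction "is")
    case (Cons i "is")
    have "cl_sign {i} (set is) = (1 :: 'a)"
      using Cons.prems by (force simp: cl_sign_def intro: prod.neutral)
    moreover have "sym_diff {i} (set is) = insert i (set is)"
      using Cons.prems by auto
    ultimately show ?case
      using Cons by (simp add: cl_mult_axis)
  qed (simp add: cl_one_def)
  from this[of "sorted_list_of_set I"] show ?thesis
    by simp
qed

lemma cl_mult_sum_left: "cl_mult (\<Sum>i\<in>A. f i) b = (\<Sum>i\<in>A. cl_mult (f i) b)"
  unfolding vec_eq_iff cl_mult_nth sum_component sum_distrib_right
  by (intro allI sum.swap)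

lemma cl_mult_sum_right: "cl_mult b (\<Sum>i\<in>A. f i) = (\<Sum>i\<in>A. cl_mult b (f i))"
  unfolding vec_eq_iff cl_mult_nth sum_component sum_distrib_right sum_distrib_left
  by (intro allI sum.swap)

lemma cl_mult_scale_left: "cl_mult (c *s a) b = c *s cl_mult a b"
  by (simp add: vec_eq_iff cl_mult_nth sum_distrib_left mult_ac)

lemma cl_mult_scale_right: "cl_mult a (c *s b) = c *s cl_mult a b"
  by (simp add: vec_eq_iff cl_mult_nth sum_distrib_left mult_ac)

lemma cl_relation_axis:
  "cl_mult (axis {i} 1) (axis {j} 1) + cl_mult (axis {j} 1) (axis {i} 1) =
    (if i = j then (- 2 :: complex) *s cl_one else 0)"
proof (cases "i = j")
  case True
  then show ?thesis
    by (simp add: cl_mult_axis cl_sign_def cl_one_def vec_eq_iff)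
next
  case False
  then have "sym_diff {i} {j} = {i, j}" "sym_diff {j} {i} = {i, j}"
    by auto
  with False show ?thesis
    by (cases "i < j") (simp_all add: cl_mult_axis cl_sign_def vec_eq_iff)
qed

lemma cl_mult_cl_vec:
  "cl_mult (cl_vec x) (cl_vec y) =
    (\<Sum>i\<in>UNIV. \<Sum>j\<in>UNIV.
      (complex_of_real (x $ i) * complex_of_real (y $ j)) *s cl_mult (axis {i} 1) (axis {j} 1))"
  unfolding cl_vec_def cl_mult_sum_left
  by (simp only: cl_mult_sum_right cl_mult_scale_left cl_mult_scale_right vector_smult_assoc
      mult.commute)

lemma cl_relation:
  "cl_mult (cl_vec x) (cl_vec y) + cl_mult (cl_vec y) (cl_vec x) =
    complex_of_real (- 2 * (x \<bullet> y)) *s cl_one"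
proof -
  let ?c = "\<lambda>i j. complex_of_real (x $ i) * complex_of_real (y $ j)"
  have "cl_mult (cl_vec y) (cl_vec x) =
      (\<Sum>j\<in>UNIV. \<Sum>i\<in>UNIV. ?c i j *s cl_mult (axis {j} 1) (axis {i} 1))"
    by (simp only: cl_mult_cl_vec mult.commute)
  also have "\<dots> = (\<Sum>i\<in>UNIV. \<Sum>j\<in>UNIV. ?c i j *s cl_mult (axis {j} 1) (axis {i} 1))"
    by (rule sum.swap)
  finally have "cl_mult (cl_vec x) (cl_vec y) + cl_mult (cl_vec y) (cl_vec x) =
      (\<Sum>i\<in>UNIV. \<Sum>j\<in>UNIV. ?c i j *s (if i = j then (- 2) *s cl_one else 0))"
    unfolding cl_mult_cl_vec[of x y]
    by (simp only: sum.distrib[symmetric] vector_add_ldistrib[symmetric] cl_relation_axis)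
  also have "\<dots> = (\<Sum>i\<in>UNIV. \<Sum>j\<in>UNIV. if j = i then ?c i j *s ((- 2) *s cl_one) else 0)"
    by (intro sum.cong refl) simp
  also have "\<dots> = complex_of_real (- 2 * (x \<bullet> y)) *s cl_one"
    by (simp add: vec_eq_iff inner_vec_def sum_distrib_left sum_distrib_right mult_ac flip: sum_negf)
  finally show ?thesis .
qed

definition clifford_rep :: "(complex ^ ('n::{finite,linorder} set) \<Rightarrow> 's \<Rightarrow> 's::complex_vector) \<Rightarrow> bool"
  where
  "clifford_rep \<rho> \<longleftrightarrow>
    (\<forall>a. clinear (\<rho> a)) \<and>
    (\<forall>a b s. \<rho> (a + b) s = \<rho> a s + \<rho> b s) \<and>
    (\<forall>c a s. \<rho> (c *s a) s = c *\<^sub>C \<rho> a s) \<and>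
    \<rho> cl_one = id \<and>
    (\<forall>a b. \<rho> (cl_mult a b) = \<rho> a \<circ> \<rho> b)"

text \<open>
  The dual representation on vectors; the operators below apply it only to vectors, so its
  multiplicative extension to the whole algebra is not needed.
\<close>

definition dual_rep ::
    "(complex ^ ('n::{finite,linorder} set) \<Rightarrow> 's \<Rightarrow> 's::complex_vector) \<Rightarrow>
     real ^ 'n::{finite,linorder} \<Rightarrow> ('s \<Rightarrow> complex) \<Rightarrow> 's \<Rightarrow> complex" where
  "dual_rep \<rho> x t = (\<lambda>s. - t (\<rho> (cl_vec x) s))"


section \<open>Smooth functions and alternating forms\<close>

primrec C_k :: "nat \<Rightarrow> ('a::euclidean_space \<Rightarrow> 'b::real_normed_vector) \<Rightarrow> bool" where
  "C_k 0 f \<longleftrightarrow> continuous_on UNIV f"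
| "C_k (Suc r) f \<longleftrightarrow>
    (\<forall>p. f differentiable (at p)) \<and> (\<forall>b\<in>Basis. C_k r (\<lambda>p. frechet_derivative f (at p) b))"

definition smooth_maps :: "('a::euclidean_space \<Rightarrow> 'b::real_normed_vector) set" where
  "smooth_maps = {f. \<forall>r. C_k r f}"

text \<open>
  Complex-valued alternating \<open>k\<close>-forms on \<open>\<real>\<^sup>n\<close>, as functions on lists of \<open>k\<close> vectors (and \<open>0\<close>
  by convention on lists of any other length).
\<close>

definition alt_forms :: "nat \<Rightarrow> ((real ^ 'n) list \<Rightarrow> complex) set" where
  "alt_forms k = {\<omega>.
    (\<forall>vs. length vs \<noteq> k \<longrightarrow> \<omega> vs = 0) \<and>
    (\<forall>vs i. length vs = k \<longrightarrow> i < k \<longrightarrow> linear (\<lambda>v. \<omega> (vs[i := v]))) \<and>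
    (\<forall>vs i j. length vs = k \<longrightarrow> i < j \<longrightarrow> j < k \<longrightarrow> vs ! i = vs ! j \<longrightarrow> \<omega> vs = 0)}"

definition smooth_forms :: "nat \<Rightarrow> (real ^ 'n \<Rightarrow> (real ^ 'n) list \<Rightarrow> complex) set" where
  "smooth_forms k = {\<omega>. (\<forall>x. \<omega> x \<in> alt_forms k) \<and> (\<forall>vs. (\<lambda>x. \<omega> x vs) \<in> smooth_maps)}"


section \<open>The differential operators\<close>

text \<open>
  The values lie in a finite-dimensional space \<open>'t\<close>, on which every norm induces the same topology;
  the sort \<^class>\<open>real_normed_vector\<close> only gives access to the library's derivative. A point of
  \<open>\<real>\<^sup>n \<times> \<real>\<^sup>n\<close> is a pair \<open>(x, y)\<close>.
\<close>

type_synonym ('n, 't) field2 = "(real, 'n) vec \<times> (real, 'n) vec \<Rightarrow> 't"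

definition dx :: "'n::finite \<Rightarrow> ('n, 't::real_normed_vector) field2 \<Rightarrow> ('n, 't) field2" where
  "dx j F p = frechet_derivative F (at p) (axis j 1, 0)"

definition dy :: "'n::finite \<Rightarrow> ('n, 't::real_normed_vector) field2 \<Rightarrow> ('n, 't) field2" where
  "dy j F p = frechet_derivative F (at p) (0, axis j 1)"

definition laplace_x :: "('n::finite, 't::real_normed_vector) field2 \<Rightarrow> ('n, 't) field2" where
  "laplace_x F p = (\<Sum>j\<in>UNIV. dx j (dx j F) p)"

definition laplace_y :: "('n::finite, 't::real_normed_vector) field2 \<Rightarrow> ('n, 't) field2" where
  "laplace_y F p = (\<Sum>j\<in>UNIV. dy j (dy j F) p)"

text \<open>\<open>act_left\<close> and \<open>act_right\<close> are \<open>\<rho>(v) \<otimes> id\<close> and \<open>id \<otimes> \<rho>'(v)\<close> on the tensor product.\<close>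

definition act_left ::
    "('s::complex_vector \<Rightarrow> ('s \<Rightarrow> complex) \<Rightarrow> 't::complex_vector) \<Rightarrow>
     (complex ^ ('n::{finite,linorder} set) \<Rightarrow> 's \<Rightarrow> 's) \<Rightarrow> real ^ 'n::{finite,linorder} \<Rightarrow> 't \<Rightarrow> 't" where
  "act_left tens \<rho> v = tensor_lift tens (\<lambda>s t. tens (\<rho> (cl_vec v) s) t)"

definition act_right ::
    "('s::complex_vector \<Rightarrow> ('s \<Rightarrow> complex) \<Rightarrow> 't::complex_vector) \<Rightarrow>
     (complex ^ ('n::{finite,linorder} set) \<Rightarrow> 's \<Rightarrow> 's) \<Rightarrow> real ^ 'n::{finite,linorder} \<Rightarrow> 't \<Rightarrow> 't" where
  "act_right tens \<rho> v = tensor_lift tens (\<lambda>s t. tens s (dual_rep \<rho> v t))"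

definition dirac_x ::
    "('s::complex_vector \<Rightarrow> ('s \<Rightarrow> complex) \<Rightarrow> 't::{complex_vector,real_normed_vector}) \<Rightarrow>
     (complex ^ ('n::{finite,linorder} set) \<Rightarrow> 's \<Rightarrow> 's) \<Rightarrow> ('n, 't) field2 \<Rightarrow> ('n, 't) field2" where
  "dirac_x tens \<rho> F p = (\<Sum>j\<in>UNIV. act_left tens \<rho> (axis j 1) (dx j F p))"

definition dirac_y ::
    "('s::complex_vector \<Rightarrow> ('s \<Rightarrow> complex) \<Rightarrow> 't::{complex_vector,real_normed_vector}) \<Rightarrow>
     (complex ^ ('n::{finite,linorder} set) \<Rightarrow> 's \<Rightarrow> 's) \<Rightarrow> ('n, 't) field2 \<Rightarrow> ('n, 't) field2" where
  "dirac_y tens \<rho> F p = (\<Sum>j\<in>UNIV. act_right tens \<rho> (axis j 1) (dy j F p))"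

text \<open>In \<open>P \<otimes> P'\<close> below, \<open>P'\<close> (acting in \<open>y\<close>) is applied before \<open>P\<close> (acting in \<open>x\<close>).\<close>

definition source_op ::
    "('s::complex_vector \<Rightarrow> ('s \<Rightarrow> complex) \<Rightarrow> 't::{complex_vector,real_normed_vector}) \<Rightarrow>
     (complex ^ ('n::{finite,linorder} set) \<Rightarrow> 's \<Rightarrow> 's) \<Rightarrow> complex \<Rightarrow> complex \<Rightarrow>
     ('n, 't) field2 \<Rightarrow> ('n, 't) field2" where
  "source_op tens \<rho> lam mu F = (\<lambda>(x, y).
     let n = of_nat CARD('n); L = act_left tens \<rho>; R = act_right tens \<rho>;
         D = dirac_x tens \<rho>; D' = dirac_y tens \<rho>; e = (\<lambda>j. axis j 1)
     in (norm (x - y))\<^sup>2 *\<^sub>R laplace_x (laplace_y F) (x, y)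
      + (2 * (2 * lam - n + 1)) *\<^sub>C (\<Sum>j\<in>UNIV. (x $ j - y $ j) *\<^sub>R dx j (laplace_y F) (x, y))
      + (2 * (2 * mu - n + 1)) *\<^sub>C (\<Sum>j\<in>UNIV. (y $ j - x $ j) *\<^sub>R laplace_x (dy j F) (x, y))
      - 2 *\<^sub>C L (x - y) (D (laplace_y F) (x, y))
      - 2 *\<^sub>C R (y - x) (laplace_x (D' F) (x, y))
      + ((2 * mu - n + 1) * (2 * mu + 1)) *\<^sub>C laplace_x F (x, y)
      + ((2 * lam - n + 1) * (2 * lam + 1)) *\<^sub>C laplace_y F (x, y)
      - (2 * (2 * lam - n + 1) * (2 * mu - n + 1)) *\<^sub>C (\<Sum>j\<in>UNIV. dx j (dy j F) (x, y))
      + (2 * (2 * lam - n + 1)) *\<^sub>C (\<Sum>j\<in>UNIV. R (e j) (dx j (D' F) (x, y)))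
      + (2 * (2 * mu - n + 1)) *\<^sub>C (\<Sum>j\<in>UNIV. L (e j) (D (dy j F) (x, y)))
      - 2 *\<^sub>C (\<Sum>j\<in>UNIV. L (e j) (R (e j) (D (D' F) (x, y)))))"

text \<open>\<open>\<Psi>\<^sup>(\<^sup>k\<^sup>)\<close> and its composition with restriction to the diagonal.\<close>

definition Psi ::
    "('s::complex_vector \<Rightarrow> ('s \<Rightarrow> complex) \<Rightarrow> 't::complex_vector) \<Rightarrow>
     (complex ^ ('n::{finite,linorder} set) \<Rightarrow> 's \<Rightarrow> 's) \<Rightarrow> nat \<Rightarrow>
     't \<Rightarrow> (real ^ 'n::{finite,linorder}) list \<Rightarrow> complex" where
  "Psi tens \<rho> k v = (THE \<omega>. \<omega> \<in> alt_forms k \<and>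
     (\<forall>is. length is = k \<longrightarrow> sorted_wrt (<) is \<longrightarrow>
        \<omega> (map (\<lambda>i. axis i 1) is) =
        tensor_lift tens (\<lambda>s t. t (foldr (\<lambda>i. \<rho> (cl_vec (axis i 1))) is s)) v))"

definition Psi_diag ::
    "('s::complex_vector \<Rightarrow> ('s \<Rightarrow> complex) \<Rightarrow> 't::complex_vector) \<Rightarrow>
     (complex ^ ('n::{finite,linorder} set) \<Rightarrow> 's \<Rightarrow> 's) \<Rightarrow> nat \<Rightarrow>
     ('n, 't) field2 \<Rightarrow> real ^ 'n::{finite,linorder} \<Rightarrow> (real ^ 'n::{finite,linorder}) list \<Rightarrow> complex" where
  "Psi_diag tens \<rho> k F = (\<lambda>x. Psi tens \<rho> k (F (x, x)))"

primrec source_iter ::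
    "('s::complex_vector \<Rightarrow> ('s \<Rightarrow> complex) \<Rightarrow> 't::{complex_vector,real_normed_vector}) \<Rightarrow>
     (complex ^ ('n::{finite,linorder} set) \<Rightarrow> 's \<Rightarrow> 's) \<Rightarrow> complex \<Rightarrow> complex \<Rightarrow> nat \<Rightarrow>
     ('n, 't) field2 \<Rightarrow> ('n, 't) field2" where
  "source_iter tens \<rho> lam mu 0 = id"
| "source_iter tens \<rho> lam mu (Suc m) =
    source_op tens \<rho> (lam + of_nat m) (mu + of_nat m) \<circ> source_iter tens \<rho> lam mu m"

definition bidiff_op ::
    "('s::complex_vector \<Rightarrow> ('s \<Rightarrow> complex) \<Rightarrow> 't::{complex_vector,real_normed_vector}) \<Rightarrow>
     (complex ^ ('n::{finite,linorder} set) \<Rightarrow> 's \<Rightarrow> 's) \<Rightarrow> nat \<Rightarrow> complex \<Rightarrow> complex \<Rightarrow> nat \<Rightarrow>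
     ('n, 't) field2 \<Rightarrow> real ^ 'n::{finite,linorder} \<Rightarrow> (real ^ 'n::{finite,linorder}) list \<Rightarrow> complex" where
  "bidiff_op tens \<rho> k lam mu m = Psi_diag tens \<rho> k \<circ> source_iter tens \<rho> lam mu m"

end

theory Submission
  imports Defs
begin

text \<open>
  The recurrence is associativity of composition: in the product of the source operators with
  parameters \<open>(\<lambda> + m - 1, \<mu> + m - 1), \<dots>, (\<lambda>, \<mu>)\<close>, removing the rightmost factor leaves the iterate of
  length \<open>m - 1\<close> that starts at \<open>(\<lambda> + 1, \<mu> + 1)\<close>; see \<open>source_iter_Suc_first\<close>. The substance lies in the claim that the operators map smooth fields to smooth fields of alternating
  forms.

  The source operator preserves smoothness (\<open>smooth_source_op\<close>) because it combines partial
  derivatives through fixed linear endomorphisms of \<open>\<S> \<otimes> \<S>'\<close> and coefficients polynomial in \<open>x - y\<close>. This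
  requires linear maps on \<open>\<S> \<otimes> \<S>'\<close> to be continuous, whereas the tensor product is given by its
  universal property alone and carries an arbitrary norm. A basis of \<open>\<S>\<close> yields coordinates on the
  tensor product (\<open>tensor_expansion\<close>), so that linear lifts exist and the space is finite-dimensional;
  on a finite-dimensional normed space every linear map is bounded
  (\<open>linear_imp_bounded_linear_finite_span\<close>).

  The map \<open>\<Psi>\<^sup>(\<^sup>k\<^sup>)\<close> prescribes an alternating form on increasing lists of basis vectors. Such a form is
  unique by multilinearity and alternation (\<open>alt_forms_eqI\<close>) and exists as a combination of coordinate
  minors (\<open>coordinate_form_basis\<close>). The resulting formula for \<open>\<Psi>\<^sup>(\<^sup>k\<^sup>)\<close> is linear in the tensor, and
  therefore inherits smoothness from the field restricted to the diagonal.
\<close>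

section \<open>Complex linear maps\<close>

lemma clinear_iff:
  "clinear f \<longleftrightarrow> (\<forall>x y. f (x + y) = f x + f y) \<and> (\<forall>c x. f (c *\<^sub>C x) = c *\<^sub>C f x)"
  by (auto simp: clinear_def vector_space_scaleC Vector_Spaces.linear_iff)

lemma clinear_add: "clinear f \<Longrightarrow> f (x + y) = f x + f y"
  and clinear_scaleC: "clinear f \<Longrightarrow> f (c *\<^sub>C x) = c *\<^sub>C f x"
  by (simp_all add: clinear_iff)

lemma clinear_imp_linear:
  assumes "clinear f"
  shows "linear f"
proof (rule linearI)
  show "f (r *\<^sub>R x) = r *\<^sub>R f x" for r x
    using clinear_scaleC[OF assms, of "complex_of_real r" x] by (simp add: scaleC_of_real)
qed (rule clinear_add[OF assms])

lemma scaleC_zero_left [simp]: "0 *\<^sub>C x = 0"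
  using scaleC_of_real[of 0 x] by simp

lemma scaleC_zero_right [simp]: "c *\<^sub>C 0 = 0"
  using scaleC_add_right[of c 0 0] by simp

lemma scaleC_sum_right: "c *\<^sub>C (\<Sum>i\<in>A. f i) = (\<Sum>i\<in>A. c *\<^sub>C f i)"
  by (induction A rule: infinite_finite_induct) (simp_all add: scaleC_add_right)

lemma clinear_sum: "clinear f \<Longrightarrow> f (\<Sum>i\<in>A. g i) = (\<Sum>i\<in>A. f (g i))"
  by (rule linear_sum[OF clinear_imp_linear])

lemma clinear_id: "clinear (\<lambda>x. x)"
  by (simp add: clinear_iff)

lemma clinear_compose: "clinear f \<Longrightarrow> clinear g \<Longrightarrow> clinear (\<lambda>x. g (f x))"
  by (simp add: clinear_iff)

lemma clinear_compose_add: "clinear f \<Longrightarrow> clinear g \<Longrightarrow> clinear (\<lambda>x. f x + g x)"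
  by (simp add: clinear_iff scaleC_add_right)

lemma clinear_scale: "clinear (\<lambda>x. c *\<^sub>C x)"
  by (simp add: clinear_iff scaleC_add_right scaleC_scaleC mult.commute)

lemma clinear_scale_vector: "clinear f \<Longrightarrow> clinear (\<lambda>x. f x *\<^sub>C w)" for f :: "_ \<Rightarrow> complex"
  by (simp add: clinear_iff scaleC_add_left scaleC_scaleC scaleC_complex_def)

lemma clinear_zero: "clinear (\<lambda>x. 0)"
  by (simp add: clinear_iff)

lemma clinear_compose_sum: "(\<And>i. i \<in> A \<Longrightarrow> clinear (f i)) \<Longrightarrow> clinear (\<lambda>x. \<Sum>i\<in>A. f i x)"
  by (induction A rule: infinite_finite_induct) (simp_all add: clinear_zero clinear_compose_add)

lemma dual_add: "t \<in> dual \<Longrightarrow> u \<in> dual \<Longrightarrow> (\<lambda>v. t v + u v) \<in> dual"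
  by (simp add: dual_def clinear_compose_add)

lemma dual_scale: "t \<in> dual \<Longrightarrow> (\<lambda>v. c * t v) \<in> dual"
  unfolding dual_def
  using clinear_compose[OF _ clinear_scale[where 'a = complex, of c]] by (simp add: scaleC_complex_def)

lemma dual_sum: "(\<And>i. i \<in> A \<Longrightarrow> t i \<in> dual) \<Longrightarrow> (\<lambda>v. \<Sum>i\<in>A. c i * t i v) \<in> dual"
  by (induction A rule: infinite_finite_induct)
    (simp_all add: dual_add dual_scale, simp_all add: dual_def clinear_zero)

text \<open>Extending a single non-zero vector to a basis yields a functional that detects it.\<close>

lemma clinear_functionals_separate:
  fixes v w :: "'w::complex_vector"
  assumes "\<And>f :: 'w \<Rightarrow> complex. clinear f \<Longrightarrow> f v = f w"
  shows "v = w"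
proof (rule ccontr)
  interpret W: vector_space "scaleC :: complex \<Rightarrow> 'w \<Rightarrow> 'w"
    by (rule vector_space_scaleC)
  interpret WC: vector_space_pair "scaleC :: complex \<Rightarrow> 'w \<Rightarrow> 'w" "scaleC :: complex \<Rightarrow> complex \<Rightarrow> complex"
    by (intro vector_space_pair.intro vector_space_scaleC)
  assume "v \<noteq> w"
  then have "W.independent {v - w}"
    by simp
  from WC.linear_independent_extend[OF this, of "\<lambda>_. 1"]
  obtain f :: "'w \<Rightarrow> complex" where f: "clinear f" "f (v - w) = 1"
    unfolding clinear_def by auto
  with assms[OF f(1)] linear_diff[OF clinear_imp_linear[OF f(1)], of v w] show False
    by simp
qed

lemma finite_dim_coordinates:
  assumes "finite_dim TYPE('s::complex_vector)"
  obtains B :: "'s::complex_vector set" and coord :: "'s::complex_vector \<Rightarrow> 's \<Rightarrow> complex"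
  where "finite B" "\<And>b. coord b \<in> dual" "\<And>s. (\<Sum>b\<in>B. coord b s *\<^sub>C b) = s"
proof -
  obtain B where "finite_dimensional_vector_space (scaleC :: complex \<Rightarrow> 's \<Rightarrow> 's) B"
    using assms by (auto simp: finite_dim_def)
  then interpret finite_dimensional_vector_space "scaleC :: complex \<Rightarrow> 's \<Rightarrow> 's" B .
  have "(\<lambda>s. representation B s b) \<in> dual" for b
    by (simp add: dual_def clinear_iff representation_add representation_scale independent_Basis
        span_Basis scaleC_complex_def)
  moreover have "(\<Sum>b\<in>B. representation B s b *\<^sub>C b) = s" for s
    by (rule sum_representation_eq) (simp_all add: independent_Basis span_Basis finite_Basis)
  ultimately show thesis
    using that[of B "\<lambda>b s. representation B s b"] finite_Basis by blast
qed


section \<open>Lifting bilinear maps to the tensor product\<close>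

lemma bilinear_dualD:
  assumes "bilinear_dual \<beta>"
  shows "t \<in> dual \<Longrightarrow> clinear (\<lambda>s. \<beta> s t)"
    and "t \<in> dual \<Longrightarrow> u \<in> dual \<Longrightarrow> \<beta> s (\<lambda>v. t v + u v) = \<beta> s t + \<beta> s u"
    and "t \<in> dual \<Longrightarrow> \<beta> s (\<lambda>v. c * t v) = c *\<^sub>C \<beta> s t"
  using assms by (auto simp: bilinear_dual_def)

lemma bilinear_dual_compose:
  assumes \<beta>: "bilinear_dual \<beta>" and \<phi>: "clinear \<phi>"
  shows "bilinear_dual (\<lambda>s t. \<phi> (\<beta> s t))"
  unfolding bilinear_dual_def
  by (intro conjI ballI allI clinear_compose[OF bilinear_dualD(1)[OF \<beta>] \<phi>])
    (simp_all only: bilinear_dualD(2,3)[OF \<beta>] clinear_add[OF \<phi>] clinear_scaleC[OF \<phi>])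

lemma bilinear_dual_sum_right:
  assumes \<beta>: "bilinear_dual \<beta>" and t: "\<And>i. i \<in> A \<Longrightarrow> t i \<in> dual"
  shows "\<beta> s (\<lambda>v. \<Sum>i\<in>A. c i * t i v) = (\<Sum>i\<in>A. c i *\<^sub>C \<beta> s (t i))"
proof -
  have zero: "\<beta> s (\<lambda>v. 0) = 0"
    using bilinear_dualD(3)[OF \<beta>, of "\<lambda>v. 0" s 0] by (simp add: dual_def clinear_zero)
  show ?thesis
    using t
    by (induction A rule: infinite_finite_induct)
      (simp_all add: zero bilinear_dualD[OF \<beta>] dual_scale dual_sum)
qed

text \<open>
  The coordinate of \<open>s \<otimes> t\<close> along \<open>b \<otimes> b'\<^sup>*\<close> is the bilinear scalar \<open>b\<^sup>*(s) t(b')\<close>, hence a linear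
  functional on the tensor product. Through these functionals every bilinear map, with values in
  any space, is a linear function of \<open>s \<otimes> t\<close>.
\<close>

lemma tensor_expansion:
  fixes tens :: "'s::complex_vector \<Rightarrow> ('s \<Rightarrow> complex) \<Rightarrow> 't::complex_vector"
  assumes fin: "finite_dim TYPE('s)" and tens: "is_tensor_product tens"
  obtains J :: "('s \<times> 's) set" and coord :: "'s \<Rightarrow> 's \<Rightarrow> complex" and \<phi> :: "'s \<times> 's \<Rightarrow> 't \<Rightarrow> complex"
  where "finite J" "\<forall>p\<in>J. clinear (\<phi> p)"
    "\<forall>\<beta> :: 's \<Rightarrow> ('s \<Rightarrow> complex) \<Rightarrow> 'w::complex_vector. bilinear_dual \<beta> \<longrightarrow> (\<forall>s. \<forall>t\<in>dual.
      (\<Sum>p\<in>J. \<phi> p (tens s t) *\<^sub>C \<beta> (fst p) (coord (snd p))) = \<beta> s t)"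
proof -
  obtain B and coord :: "'s \<Rightarrow> 's \<Rightarrow> complex" where B: "finite B" "\<And>b. coord b \<in> dual"
      "\<And>s. (\<Sum>b\<in>B. coord b s *\<^sub>C b) = s"
    using finite_dim_coordinates[OF fin] by blast
  have "\<exists>\<phi>. clinear \<phi> \<and> (\<forall>s. \<forall>t\<in>dual. \<phi> (tens s t) = coord b s * t b')" for b b'
  proof -
    have "bilinear_dual (\<lambda>s t. coord b s * t b')"
      using B(2)[of b]
      by (auto simp: bilinear_dual_def dual_def clinear_iff scaleC_complex_def algebra_simps)
    then show ?thesis
      using tens unfolding is_tensor_product_def by blast
  qed
  then obtain \<phi> where \<phi>: "\<And>b b'. clinear (\<phi> b b')"
      "\<And>b b' s t. t \<in> dual \<Longrightarrow> \<phi> b b' (tens s t) = coord b s * t b'"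
    by metis
  have expand: "(\<Sum>p\<in>B \<times> B. \<phi> (fst p) (snd p) (tens s t) *\<^sub>C \<beta> (fst p) (coord (snd p))) = \<beta> s t"
    if \<beta>: "bilinear_dual \<beta>" and t: "t \<in> dual" for \<beta> :: "'s \<Rightarrow> ('s \<Rightarrow> complex) \<Rightarrow> 'w" and s t
  proof -
    have t_eq: "t = (\<lambda>v. \<Sum>b'\<in>B. t b' * coord b' v)"
    proof
      fix v
      have "t v = t (\<Sum>b\<in>B. coord b v *\<^sub>C b)"
        by (simp only: B(3))
      also have "\<dots> = (\<Sum>b'\<in>B. t b' * coord b' v)"
        using t by (simp add: dual_def clinear_sum clinear_scaleC scaleC_complex_def mult.commute)
      finally show "t v = (\<Sum>b'\<in>B. t b' * coord b' v)" .
    qed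
    have "\<beta> s t = \<beta> (\<Sum>b\<in>B. coord b s *\<^sub>C b) t"
      by (simp only: B(3))
    also have "\<dots> = (\<Sum>b\<in>B. coord b s *\<^sub>C \<beta> b t)"
      by (simp only: clinear_sum[OF bilinear_dualD(1)[OF \<beta> t]] clinear_scaleC[OF bilinear_dualD(1)[OF \<beta> t]])
    also have "\<dots> = (\<Sum>b\<in>B. coord b s *\<^sub>C (\<Sum>b'\<in>B. t b' *\<^sub>C \<beta> b (coord b')))"
      by (simp only: bilinear_dual_sum_right[OF \<beta> B(2), symmetric] t_eq[symmetric])
    also have "\<dots> = (\<Sum>p\<in>B \<times> B. \<phi> (fst p) (snd p) (tens s t) *\<^sub>C \<beta> (fst p) (coord (snd p)))"
      by (simp add: sum.cartesian_product' scaleC_sum_right scaleC_scaleC \<phi>(2)[OF t])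
    finally show ?thesis ..
  qed
  show thesis
    by (rule that[of "B \<times> B" "\<lambda>p. \<phi> (fst p) (snd p)" coord]) (use B(1) \<phi>(1) expand in simp_all)
qed

text \<open>
  The universal property decides the claim for scalar-valued maps; functionals on the target space
  transfer it to vector-valued ones.
\<close>

lemma tensor_lift_unique:
  fixes tens :: "'s::complex_vector \<Rightarrow> ('s \<Rightarrow> complex) \<Rightarrow> 't::complex_vector"
    and \<phi> \<psi> :: "'t \<Rightarrow> 'w::complex_vector"
  assumes tens: "is_tensor_product tens" and \<phi>: "clinear \<phi>" and \<psi>: "clinear \<psi>"
    and eq: "\<And>s t. t \<in> dual \<Longrightarrow> \<phi> (tens s t) = \<psi> (tens s t)"
  shows "\<phi> = \<psi>"
proof (rule ext, rule clinear_functionals_separate)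
  fix v and f :: "'w \<Rightarrow> complex"
  assume f: "clinear f"
  have "bilinear_dual tens"
    using tens unfolding is_tensor_product_def by blast
  then have "bilinear_dual (\<lambda>s t. f (\<phi> (tens s t)))"
    by (rule bilinear_dual_compose[OF bilinear_dual_compose[OF _ \<phi>] f])
  then have "\<exists>!\<xi>. clinear \<xi> \<and> (\<forall>s. \<forall>t\<in>dual. \<xi> (tens s t) = f (\<phi> (tens s t)))"
    using tens unfolding is_tensor_product_def by blast
  moreover have "clinear (\<lambda>v. f (\<phi> v)) \<and> (\<forall>s. \<forall>t\<in>dual. f (\<phi> (tens s t)) = f (\<phi> (tens s t)))"
    using clinear_compose[OF \<phi> f] by simp
  moreover have "clinear (\<lambda>v. f (\<psi> v)) \<and> (\<forall>s. \<forall>t\<in>dual. f (\<psi> (tens s t)) = f (\<phi> (tens s t)))"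
    using clinear_compose[OF \<psi> f] eq by simp
  ultimately have "(\<lambda>v. f (\<phi> v)) = (\<lambda>v. f (\<psi> v))"
    unfolding Ex1_def by metis
  then show "f (\<phi> v) = f (\<psi> v)"
    by (rule fun_cong)
qed

text \<open>
  Replacing the scalars \<open>b\<^sup>*(s) t(b')\<close> in the expansion of \<open>\<beta> s t\<close> by the functionals that they induce
  on the tensor product exhibits the lift explicitly.
\<close>

lemma tensor_lift:
  fixes tens :: "'s::complex_vector \<Rightarrow> ('s \<Rightarrow> complex) \<Rightarrow> 't::complex_vector"
    and \<beta> :: "'s \<Rightarrow> ('s \<Rightarrow> complex) \<Rightarrow> 'w::complex_vector"
  assumes fin: "finite_dim TYPE('s)" and tens: "is_tensor_product tens" and \<beta>: "bilinear_dual \<beta>"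
  shows clinear_tensor_lift: "clinear (tensor_lift tens \<beta>)"
    and tensor_lift_tens: "t \<in> dual \<Longrightarrow> tensor_lift tens \<beta> (tens s t) = \<beta> s t"
proof -
  obtain J and coord :: "'s \<Rightarrow> 's \<Rightarrow> complex" and \<phi> where J: "finite J" "\<forall>p\<in>J. clinear (\<phi> p)"
    "\<forall>\<beta> :: 's \<Rightarrow> ('s \<Rightarrow> complex) \<Rightarrow> 'w. bilinear_dual \<beta> \<longrightarrow> (\<forall>s. \<forall>t\<in>dual.
      (\<Sum>p\<in>J. \<phi> p (tens s t) *\<^sub>C \<beta> (fst p) (coord (snd p))) = \<beta> s t)"
    by (rule tensor_expansion[OF fin tens, where 'w = 'w]) (rule that)
  let ?\<psi> = "\<lambda>v. \<Sum>p\<in>J. \<phi> p v *\<^sub>C \<beta> (fst p) (coord (snd p))"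
  have "clinear ?\<psi> \<and> (\<forall>s. \<forall>t\<in>dual. ?\<psi> (tens s t) = \<beta> s t)"
    using J(2) J(3)[rule_format, OF \<beta>] by (simp add: clinear_compose_sum clinear_scale_vector)
  then have "\<exists>!\<psi>. clinear \<psi> \<and> (\<forall>s. \<forall>t\<in>dual. \<psi> (tens s t) = \<beta> s t)"
    by (intro ex1I[of _ ?\<psi>]) (auto intro!: tensor_lift_unique[OF tens])
  from theI'[OF this] show "clinear (tensor_lift tens \<beta>)"
    and "t \<in> dual \<Longrightarrow> tensor_lift tens \<beta> (tens s t) = \<beta> s t"
    by (simp_all add: tensor_lift_def)
qed

text \<open>
  The expansion of the bilinear map \<open>\<otimes>\<close> itself writes every tensor as a complex combination of finitely
  many simple ones; over the reals these are joined by their multiples by \<open>\<i>\<close>.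
\<close>

lemma tensor_product_finite_real_span:
  fixes tens :: "'s::complex_vector \<Rightarrow> ('s \<Rightarrow> complex) \<Rightarrow> 't::complex_vector"
  assumes fin: "finite_dim TYPE('s)" and tens: "is_tensor_product tens"
  obtains S :: "'t set" where "finite S" "span S = UNIV"
proof -
  obtain J and coord :: "'s \<Rightarrow> 's \<Rightarrow> complex" and \<phi> where J: "finite J" "\<forall>p\<in>J. clinear (\<phi> p)"
    "\<forall>\<beta> :: 's \<Rightarrow> ('s \<Rightarrow> complex) \<Rightarrow> 't. bilinear_dual \<beta> \<longrightarrow> (\<forall>s. \<forall>t\<in>dual.
      (\<Sum>p\<in>J. \<phi> p (tens s t) *\<^sub>C \<beta> (fst p) (coord (snd p))) = \<beta> s t)"
    by (rule tensor_expansion[OF fin tens, where 'w = 't]) (rule that)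
  define u where "u p = tens (fst p) (coord (snd p))" for p
  have "bilinear_dual tens"
    using tens unfolding is_tensor_product_def by blast
  then have "(\<lambda>v. \<Sum>p\<in>J. \<phi> p v *\<^sub>C u p) = (\<lambda>v. v)"
    using J(2) J(3)[rule_format, of tens] unfolding u_def
    by (intro tensor_lift_unique[OF tens] clinear_compose_sum clinear_scale_vector clinear_id) simp_all
  then have expand: "(\<Sum>p\<in>J. \<phi> p v *\<^sub>C u p) = v" for v
    by (rule fun_cong)
  let ?S = "u ` J \<union> (\<lambda>p. \<i> *\<^sub>C u p) ` J"
  have split: "c *\<^sub>C x = Re c *\<^sub>R x + Im c *\<^sub>R (\<i> *\<^sub>C x)" for c and x :: 't
  proof -
    have "c *\<^sub>C x = (complex_of_real (Re c) + complex_of_real (Im c) * \<i>) *\<^sub>C x"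
      by (simp add: mult.commute flip: complex_eq)
    then show ?thesis
      by (simp only: scaleC_add_left scaleC_of_real scaleC_scaleC[symmetric])
  qed
  have "\<phi> p v *\<^sub>C u p \<in> span ?S" if "p \<in> J" for p v
    using that by (subst split[of "\<phi> p v" "u p"]) (intro span_add span_scale span_base; blast)
  then have "(\<Sum>p\<in>J. \<phi> p v *\<^sub>C u p) \<in> span ?S" for v
    by (rule span_sum)
  then have "v \<in> span ?S" for v
    unfolding expand .
  with that[of ?S] J(1) show thesis
    by blast
qed


section \<open>Linear maps on finite-dimensional normed spaces\<close>

text \<open>
  Up to a constant, any norm on a finite-dimensional space dominates the sum of the absolute
  coordinates: on the compact set of coefficient vectors with absolute sum \<open>1\<close> the norm of the
  combination attains a minimum, and independence keeps that minimum away from \<open>0\<close>.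
\<close>

lemma independent_coefficients_bound:
  fixes B :: "'t::real_normed_vector set"
  assumes B: "finite B" "independent B"
  obtains c where "c > 0" "\<And>a. c * (\<Sum>b\<in>B. \<bar>a b\<bar>) \<le> norm (\<Sum>b\<in>B. a b *\<^sub>R b)"
proof (cases "B = {}")
  case True
  then show thesis
    using that[of 1] by simp
next
  case False
  \<comment> \<open>functions on the whole type, confined to \<open>0\<close> outside \<open>B\<close>, so that Tychonoff's theorem applies\<close>
  define box :: "('t \<Rightarrow> real) set" where "box = (\<Pi>\<^sub>E b\<in>UNIV. if b \<in> B then {- 1..1} else {0})"
  define K where "K = box \<inter> {a. (\<Sum>b\<in>B. \<bar>a b\<bar>) = 1}"
  have "compactin (product_topology (\<lambda>_. euclidean) UNIV) box"
    unfolding box_def compactin_PiE by auto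
  then have "compact box"
    by (simp add: euclidean_product_topology)
  moreover have "closed {a :: 't \<Rightarrow> real. (\<Sum>b\<in>B. \<bar>a b\<bar>) = 1}"
    by (intro closed_Collect_eq continuous_intros continuous_on_product_coordinates)
  ultimately have K: "compact K"
    unfolding K_def by blast
  obtain b0 where b0: "b0 \<in> B"
    using False by blast
  have "(\<lambda>b. if b = b0 then 1 else 0) \<in> K"
    using b0 B(1) by (auto simp: K_def box_def if_distrib[of abs] cong: if_cong)
  then have "K \<noteq> {}"
    by blast
  moreover have "continuous_on K (\<lambda>a. norm (\<Sum>b\<in>B. a b *\<^sub>R b))"
    by (intro continuous_intros continuous_on_subset[OF continuous_on_product_coordinates]) auto
  ultimately obtain a0 where a0: "a0 \<in> K"
      "\<And>a. a \<in> K \<Longrightarrow> norm (\<Sum>b\<in>B. a0 b *\<^sub>R b) \<le> norm (\<Sum>b\<in>B. a b *\<^sub>R b)"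
    using continuous_attains_inf[OF K] by blast
  let ?c = "norm (\<Sum>b\<in>B. a0 b *\<^sub>R b)"
  have "?c \<noteq> 0"
  proof
    assume "?c = 0"
    then have "\<forall>b\<in>B. a0 b = 0"
      using independentD[OF B(2,1) subset_refl] by simp
    then show False
      using a0(1) by (simp add: K_def)
  qed
  then have "?c > 0"
    by simp
  moreover have "?c * (\<Sum>b\<in>B. \<bar>a b\<bar>) \<le> norm (\<Sum>b\<in>B. a b *\<^sub>R b)" for a
  proof (cases "(\<Sum>b\<in>B. \<bar>a b\<bar>) = 0")
    case False
    define r where "r = (\<Sum>b\<in>B. \<bar>a b\<bar>)"
    have r: "r > 0"
      using False unfolding r_def by (simp add: sum_nonneg order.not_eq_order_implies_strict)
    define a1 where "a1 b = (if b \<in> B then a b / r else 0)" for b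
    have "\<bar>a b\<bar> \<le> r" if "b \<in> B" for b
      unfolding r_def using that B(1) by (intro member_le_sum) auto
    then have "a b \<le> r \<and> - r \<le> a b" if "b \<in> B" for b
      using that by (meson abs_le_D1 abs_le_D2 minus_le_iff)
    then have "a1 \<in> box"
      using r by (auto simp: box_def a1_def field_simps)
    moreover have "(\<Sum>b\<in>B. \<bar>a1 b\<bar>) = 1"
      using r by (simp add: a1_def flip: sum_divide_distrib) (simp add: r_def)
    ultimately have "?c \<le> norm (\<Sum>b\<in>B. a1 b *\<^sub>R b)"
      by (intro a0(2)) (simp add: K_def)
    also have "(\<Sum>b\<in>B. a1 b *\<^sub>R b) = (1 / r) *\<^sub>R (\<Sum>b\<in>B. a b *\<^sub>R b)"
      by (simp add: a1_def scaleR_sum_right divide_inverse mult.commute)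
    finally show ?thesis
      using r by (simp add: r_def[symmetric] field_simps)
  qed simp
  ultimately show thesis
    by (rule that)
qed

lemma linear_imp_bounded_linear_finite_span:
  fixes S :: "'t::real_normed_vector set" and f :: "'t \<Rightarrow> 'w::real_normed_vector"
  assumes S: "finite S" "span S = UNIV" and f: "linear f"
  shows "bounded_linear f"
proof -
  obtain B :: "'t set" where B: "B \<subseteq> S" "independent B" "S \<subseteq> span B"
    by (rule real_vector.maximal_independent_subset[of S])
  have fin: "finite B"
    using B(1) S(1) by (rule finite_subset)
  have span: "span B = UNIV"
    using S(2) span_minimal[OF B(3) subspace_span] by auto
  obtain c where c: "c > 0" "\<And>a. c * (\<Sum>b\<in>B. \<bar>a b\<bar>) \<le> norm (\<Sum>b\<in>B. a b *\<^sub>R b)"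
    using independent_coefficients_bound[OF fin B(2)] by blast
  define M where "M = (\<Sum>b\<in>B. norm (f b))"
  have "norm (f v) \<le> norm v * (M / c)" for v
  proof -
    define a where "a = representation B v"
    have v: "(\<Sum>b\<in>B. a b *\<^sub>R b) = v"
      unfolding a_def by (rule real_vector.sum_representation_eq) (use B(2) span fin in auto)
    have "norm (f v) = norm (\<Sum>b\<in>B. a b *\<^sub>R f b)"
      by (subst v[symmetric]) (simp add: linear_sum[OF f] linear_cmul[OF f])
    also have "\<dots> \<le> (\<Sum>b\<in>B. \<bar>a b\<bar> * norm (f b))"
      by (rule order.trans[OF norm_sum]) simp
    also have "\<dots> \<le> (\<Sum>b\<in>B. \<bar>a b\<bar> * M)"
      unfolding M_def using fin by (intro sum_mono mult_left_mono member_le_sum) auto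
    also have "\<dots> = (\<Sum>b\<in>B. \<bar>a b\<bar>) * M"
      by (simp add: sum_distrib_right)
    also have "\<dots> \<le> (norm v / c) * M"
      using c(1) c(2)[of a] unfolding v
      by (intro mult_right_mono) (auto simp: M_def field_simps sum_nonneg)
    finally show ?thesis
      by (simp add: field_simps)
  qed
  then show ?thesis
    by (intro bounded_linear_intro[of f "M / c"] linear_add[OF f] linear_cmul[OF f])
qed


section \<open>Closure properties of smooth maps\<close>

text \<open>
  This lets the derivative be supplied by the usual differentiation rules, so that each closure
  property below is an induction on the order whose step is one such rule.
\<close>

lemma C_k_SucI:
  assumes "\<And>p. (f has_derivative f' p) (at p)" and "\<And>b. b \<in> Basis \<Longrightarrow> C_k r (\<lambda>p. f' p b)"
  shows "C_k (Suc r) f"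
proof -
  have "frechet_derivative f (at p) = f' p" for p
    using frechet_derivative_at[OF assms(1)] by simp
  with assms show ?thesis
    by (auto simp: differentiable_def)
qed

lemma C_k_SucD:
  assumes "C_k (Suc r) f"
  shows "(f has_derivative frechet_derivative f (at p)) (at p)"
    and "b \<in> Basis \<Longrightarrow> C_k r (\<lambda>p. frechet_derivative f (at p) b)"
  using assms by (simp_all add: frechet_derivative_works)

lemma C_k_weaken: "C_k (Suc r) f \<Longrightarrow> C_k r f"
proof (induction r arbitrary: f)
  case 0
  then show ?case
    by (auto intro!: differentiable_imp_continuous_on simp: differentiable_on_def
        intro: differentiable_at_withinI)
next
  case (Suc r)
  show ?case
    by (rule C_k_SucI[OF C_k_SucD(1)[OF Suc.prems] Suc.IH[OF C_k_SucD(2)[OF Suc.prems]]])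
qed

lemma C_k_const: "C_k r (\<lambda>_. c)"
  by (induction r arbitrary: c) (auto intro: C_k_SucI has_derivative_const)

lemma C_k_add: "C_k r f \<Longrightarrow> C_k r g \<Longrightarrow> C_k r (\<lambda>p. f p + g p)"
proof (induction r arbitrary: f g)
  case (Suc r)
  show ?case
    by (rule C_k_SucI[OF has_derivative_add[OF Suc.prems[THEN C_k_SucD(1)]]])
      (rule Suc.IH[OF Suc.prems[THEN C_k_SucD(2)]])
qed (auto intro: continuous_on_add)

lemma C_k_sum: "(\<And>i. i \<in> A \<Longrightarrow> C_k r (f i)) \<Longrightarrow> C_k r (\<lambda>p. \<Sum>i\<in>A. f i p)"
  by (induction A rule: infinite_finite_induct) (simp_all add: C_k_const C_k_add)

lemma C_k_bounded_linear: "bounded_linear T \<Longrightarrow> C_k r f \<Longrightarrow> C_k r (\<lambda>p. T (f p))"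
proof (induction r arbitrary: f)
  case (Suc r)
  show ?case
    by (rule C_k_SucI[OF bounded_linear.has_derivative[OF Suc.prems(1) C_k_SucD(1)[OF Suc.prems(2)]]])
      (rule Suc.IH[OF Suc.prems(1) C_k_SucD(2)[OF Suc.prems(2)]])
qed (auto intro: bounded_linear.continuous_on)

lemma C_k_scaleR: "C_k r g \<Longrightarrow> C_k r f \<Longrightarrow> C_k r (\<lambda>p. g p *\<^sub>R f p)"
proof (induction r arbitrary: f g)
  case (Suc r)
  show ?case
    by (rule C_k_SucI[OF has_derivative_scaleR[OF Suc.prems[THEN C_k_SucD(1)]]])
      (rule C_k_add[OF Suc.IH[OF C_k_weaken C_k_SucD(2)] Suc.IH[OF C_k_SucD(2) C_k_weaken]];
        (assumption | rule Suc.prems))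
qed (auto intro: continuous_on_scaleR)

lemma C_k_of_bounded_linear:
  assumes "bounded_linear f"
  shows "C_k r f"
proof (cases r)
  case 0
  then show ?thesis
    using linear_continuous_on[OF assms] by simp
next
  case (Suc r')
  show ?thesis
    unfolding Suc
    by (rule C_k_SucI[OF bounded_linear_imp_has_derivative[OF assms]]) (rule C_k_const)
qed

text \<open>
  For the composition with a linear map of the variable, the chain rule is written in coordinates,
  so that its right-hand side again consists of partial derivatives of the outer function.
\<close>

lemma C_k_compose_linear:
  fixes A :: "'a::euclidean_space \<Rightarrow> 'b::euclidean_space"
  assumes A: "bounded_linear A"
  shows "C_k r f \<Longrightarrow> C_k r (\<lambda>p. f (A p))"
proof (induction r arbitrary: f)
  case 0
  then show ?case
    using continuous_on_compose2[OF _ linear_continuous_on[OF A], of UNIV f UNIV] by simp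
next
  case (Suc r)
  let ?f' = "\<lambda>q. frechet_derivative f (at q)"
  have lin: "linear (?f' q)" for q
    using C_k_SucD(1)[OF Suc.prems] by (rule has_derivative_linear)
  have "((\<lambda>p. f (A p)) has_derivative (\<lambda>h. ?f' (A p) (A h))) (at p)" for p
    using has_derivative_compose[OF bounded_linear_imp_has_derivative[OF A] C_k_SucD(1)[OF Suc.prems]] .
  moreover have "(\<lambda>h. ?f' (A p) (A h)) = (\<lambda>h. \<Sum>c\<in>Basis. (A h \<bullet> c) *\<^sub>R ?f' (A p) c)" for p
  proof
    fix h
    have "?f' (A p) (A h) = ?f' (A p) (\<Sum>c\<in>Basis. (A h \<bullet> c) *\<^sub>R c)"
      by (simp only: euclidean_representation)
    then show "?f' (A p) (A h) = (\<Sum>c\<in>Basis. (A h \<bullet> c) *\<^sub>R ?f' (A p) c)"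
      by (simp add: linear_sum[OF lin] linear_cmul[OF lin])
  qed
  ultimately have "((\<lambda>p. f (A p)) has_derivative (\<lambda>h. \<Sum>c\<in>Basis. (A h \<bullet> c) *\<^sub>R ?f' (A p) c)) (at p)" for p
    by simp
  then show ?case
    by (rule C_k_SucI) (intro C_k_sum C_k_scaleR C_k_const Suc.IH C_k_SucD(2)[OF Suc.prems])
qed

lemma smooth_maps_add:
  "f \<in> smooth_maps \<Longrightarrow> g \<in> smooth_maps \<Longrightarrow> (\<lambda>p. f p + g p) \<in> smooth_maps"
  by (simp add: smooth_maps_def C_k_add)

lemma smooth_maps_sum:
  "(\<And>i. i \<in> A \<Longrightarrow> f i \<in> smooth_maps) \<Longrightarrow> (\<lambda>p. \<Sum>i\<in>A. f i p) \<in> smooth_maps"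
  by (simp add: smooth_maps_def C_k_sum)

lemma smooth_maps_bounded_linear:
  "bounded_linear T \<Longrightarrow> f \<in> smooth_maps \<Longrightarrow> (\<lambda>p. T (f p)) \<in> smooth_maps"
  by (simp add: smooth_maps_def C_k_bounded_linear)

lemma smooth_maps_diff:
  "f \<in> smooth_maps \<Longrightarrow> g \<in> smooth_maps \<Longrightarrow> (\<lambda>p. f p - g p) \<in> smooth_maps"
  using smooth_maps_add[OF _ smooth_maps_bounded_linear[OF bounded_linear_minus[OF bounded_linear_ident]], of f g]
  by simp

lemma smooth_maps_scaleR:
  "g \<in> smooth_maps \<Longrightarrow> f \<in> smooth_maps \<Longrightarrow> (\<lambda>p. g p *\<^sub>R f p) \<in> smooth_maps"
  by (simp add: smooth_maps_def C_k_scaleR)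

lemma smooth_maps_of_bounded_linear: "bounded_linear f \<Longrightarrow> f \<in> smooth_maps"
  by (simp add: smooth_maps_def C_k_of_bounded_linear)

lemma smooth_maps_compose_linear:
  "f \<in> smooth_maps \<Longrightarrow> bounded_linear A \<Longrightarrow> (\<lambda>p. f (A p)) \<in> smooth_maps"
  by (simp add: smooth_maps_def C_k_compose_linear)

lemma smooth_maps_partial:
  "f \<in> smooth_maps \<Longrightarrow> b \<in> Basis \<Longrightarrow> (\<lambda>p. frechet_derivative f (at p) b) \<in> smooth_maps"
  unfolding smooth_maps_def using C_k_SucD(2) by blast


section \<open>Alternating forms with prescribed values on the standard basis\<close>

lemma alt_formsD:
  assumes "\<omega> \<in> alt_forms k"
  shows "length vs \<noteq> k \<Longrightarrow> \<omega> vs = 0"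
    and "length vs = k \<Longrightarrow> i < k \<Longrightarrow> linear (\<lambda>v. \<omega> (vs[i := v]))"
    and "length vs = k \<Longrightarrow> i < j \<Longrightarrow> j < k \<Longrightarrow> vs ! i = vs ! j \<Longrightarrow> \<omega> vs = 0"
  using assms unfolding alt_forms_def by blast+

lemma alt_forms_sum:
  fixes \<omega> :: "'i \<Rightarrow> (real ^ 'n::finite) list \<Rightarrow> complex"
  assumes "\<And>i. i \<in> A \<Longrightarrow> \<omega> i \<in> alt_forms k"
  shows "(\<lambda>vs. \<Sum>i\<in>A. c i * \<omega> i vs) \<in> alt_forms k"
  unfolding alt_forms_def
proof (intro CollectI conjI allI impI)
  fix vs :: "(real ^ 'n) list" and i
  assume "length vs = k" "i < k"
  then have "linear (\<lambda>v. c a * \<omega> a (vs[i := v]))" if "a \<in> A" for a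
    using linear_compose[OF alt_formsD(2)[OF assms[OF that]]
        bounded_linear.linear[OF bounded_linear_mult_right[of "c a"]]]
    by (simp add: o_def)
  then show "linear (\<lambda>v. \<Sum>a\<in>A. c a * \<omega> a (vs[i := v]))"
    by (intro linear_compose_sum ballI)
next
  fix vs :: "(real ^ 'n) list"
  assume "length vs \<noteq> k"
  then show "(\<Sum>a\<in>A. c a * \<omega> a vs) = 0"
    using alt_formsD(1)[OF assms] by (intro sum.neutral) simp
next
  fix vs :: "(real ^ 'n) list" and i j
  assume "length vs = k" "i < j" "j < k" "vs ! i = vs ! j"
  then have "\<omega> a vs = 0" if "a \<in> A" for a
    using alt_formsD(3)[OF assms[OF that]] by blast
  then show "(\<Sum>a\<in>A. c a * \<omega> a vs) = 0"
    by (intro sum.neutral) simp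
qed

text \<open>
  Polarization: a bilinear map that vanishes on the diagonal is antisymmetric.
\<close>

lemma alt_forms_swap:
  assumes \<omega>: "\<omega> \<in> alt_forms k" and len: "length vs = k" and ij: "i < j" "j < k"
  shows "\<omega> (vs[i := vs ! j, j := vs ! i]) = - \<omega> vs"
proof -
  define g where "g u w = \<omega> (vs[i := u, j := w])" for u w
  have right: "g u (w + w') = g u w + g u w'" for u w w'
    unfolding g_def using linear_add[OF alt_formsD(2)[OF \<omega>, of "vs[i := u]" j]] len ij by simp
  have left: "g (u + u') w = g u w + g u' w" for u u' w
    unfolding g_def list_update_swap[OF less_imp_neq[OF ij(1)]]
    using linear_add[OF alt_formsD(2)[OF \<omega>, of "vs[j := w]" i]] len ij by simp
  have diag: "g u u = 0" for u
    unfolding g_def using len ij by (intro alt_formsD(3)[OF \<omega>, of _ i j]) auto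
  have "g (vs ! j) (vs ! i) + g (vs ! i) (vs ! j) = 0"
    using diag[of "vs ! j + vs ! i"] unfolding left right by (simp add: diag add.commute)
  then show ?thesis
    by (simp add: g_def eq_neg_iff_add_eq_0)
qed

text \<open>
  Every permutation is a product of transpositions, each of which only changes the sign.
\<close>

lemma alt_forms_permute_zero:
  assumes \<omega>: "\<omega> \<in> alt_forms k" and "p permutes {..<k}"
  shows "length vs = k \<Longrightarrow> \<omega> vs = 0 \<Longrightarrow> \<omega> (permute_list p vs) = 0"
  using assms(2) finite_lessThan[of k]
proof (induction p arbitrary: vs rule: permutes_induct)
  case id
  then show ?case
    by simp
next
  case (swap a b p)
  let ?ws = "permute_list (Transposition.transpose a b) vs"
  have ws: "?ws = vs[a := vs ! b, b := vs ! a]"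
    using swap.hyps swap.prems
    by (intro nth_equalityI) (auto simp: permute_list_def Transposition.transpose_def nth_list_update)
  have "\<omega> ?ws = - \<omega> vs"
  proof (cases "a < b")
    case True
    then show ?thesis
      unfolding ws using swap by (intro alt_forms_swap[OF \<omega>]) auto
  next
    case False
    then have "b < a"
      using swap.hyps by simp
    then show ?thesis
      unfolding ws list_update_swap[OF \<open>a \<noteq> b\<close>] using swap by (intro alt_forms_swap[OF \<omega>]) auto
  qed
  then have "\<omega> (permute_list p ?ws) = 0"
    using swap.prems by (intro swap.IH) simp_all
  moreover have "permute_list (Transposition.transpose a b \<circ> p) vs = permute_list p ?ws"
    using swap.hyps swap.prems by (intro permute_list_compose) simp
  ultimately show ?case
    by (simp only:)
qed

text \<open>
  Multilinearity reduces a form to its values on lists of basis vectors. Among these, lists with a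
  repetition are annihilated, and sorting the others changes the value only by a sign.
\<close>

lemma alt_forms_zeroI:
  fixes \<omega> :: "(real ^ 'n::{finite,linorder}) list \<Rightarrow> complex"
  assumes \<omega>: "\<omega> \<in> alt_forms k"
    and sorted: "\<And>is. length is = k \<Longrightarrow> sorted_wrt (<) is \<Longrightarrow> \<omega> (map (\<lambda>i. axis i 1) is) = 0"
  shows "\<omega> = (\<lambda>_. 0)"
proof
  let ?e = "\<lambda>i :: 'n. axis i (1 :: real)"
  have basis: "\<omega> (map ?e is) = 0" if len: "length is = k" for "is"
  proof (cases "distinct is")
    case False
    then obtain i j where "i < j" "j < k" "is ! i = is ! j"
      using len unfolding distinct_conv_nth by (metis linorder_neqE_nat)
    then show ?thesis
      using len by (intro alt_formsD(3)[OF \<omega>, of _ i j]) auto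
  next
    case True
    obtain p where p: "p permutes {..<length (sort is)}" "permute_list p (sort is) = is"
      using mset_eq_permutation[of "is" "sort is"] by auto
    have "\<omega> (map ?e (sort is)) = 0"
      using len True by (intro sorted) (auto simp: strict_sorted_iff)
    then have "\<omega> (permute_list p (map ?e (sort is))) = 0"
      using p(1) len by (intro alt_forms_permute_zero[OF \<omega>]) simp_all
    then show ?thesis
      using permute_list_map[OF p(1), of ?e] p(2) by simp
  qed
  \<comment> \<open>expanding one entry after another in the basis\<close>
  have expand: "\<omega> vs = 0"
    if "length vs = k" "m \<le> k" "\<And>i. m \<le> i \<Longrightarrow> i < k \<Longrightarrow> vs ! i \<in> range ?e" for m vs
    using that
  proof (induction m arbitrary: vs)
    case 0
    have "\<exists>i. v = ?e i" if v: "v \<in> set vs" for v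
    proof -
      obtain a where "a < k" "v = vs ! a"
        using v 0(1) by (auto simp: in_set_conv_nth)
      then show ?thesis
        using 0(3)[of a] by auto
    qed
    then obtain "is" where "vs = map ?e is"
      using ex_map_conv[of vs ?e] by auto
    then show ?case
      using basis[of "is"] 0(1) by simp
  next
    case (Suc m)
    have m: "m < k"
      using Suc.prems by simp
    have lin: "linear (\<lambda>v. \<omega> (vs[m := v]))"
      using alt_formsD(2)[OF \<omega>] Suc.prems m by simp
    have "\<omega> vs = \<omega> (vs[m := \<Sum>j\<in>UNIV. (vs ! m $ j) *\<^sub>R ?e j])"
      using basis_expansion[of "vs ! m"] by (simp add: scalar_mult_eq_scaleR)
    also have "\<dots> = (\<Sum>j\<in>UNIV. (vs ! m $ j) *\<^sub>R \<omega> (vs[m := ?e j]))"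
      by (simp add: linear_sum[OF lin] linear_cmul[OF lin])
    also have "\<dots> = 0"
    proof (intro sum.neutral ballI)
      fix j
      have "vs[m := ?e j] ! i \<in> range ?e" if "m \<le> i" "i < k" for i
        using that Suc.prems by (cases "i = m") auto
      then show "(vs ! m $ j) *\<^sub>R \<omega> (vs[m := ?e j]) = 0"
        using Suc.prems m by (subst Suc.IH) auto
    qed
    finally show ?case .
  qed
  show "\<omega> vs = 0" for vs
    using expand[of vs k] alt_formsD(1)[OF \<omega>, of vs] by (cases "length vs = k") auto
qed

lemma alt_forms_eqI:
  fixes \<omega> \<eta> :: "(real ^ 'n::{finite,linorder}) list \<Rightarrow> complex"
  assumes "\<omega> \<in> alt_forms k" "\<eta> \<in> alt_forms k"
    and eq: "\<And>is. length is = k \<Longrightarrow> sorted_wrt (<) is \<Longrightarrow>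
      \<omega> (map (\<lambda>i. axis i 1) is) = \<eta> (map (\<lambda>i. axis i 1) is)"
  shows "\<omega> = \<eta>"
proof -
  \<comment> \<open>the difference, written as a combination indexed by the two truth values\<close>
  let ?d = "\<lambda>vs. \<Sum>b\<in>UNIV. (if b then 1 else - 1) * (if b then \<omega> else \<eta>) vs"
  have "?d = (\<lambda>_. 0)"
    using assms by (intro alt_forms_zeroI[of _ k] alt_forms_sum) (auto simp: UNIV_bool)
  then show ?thesis
    by (auto simp: UNIV_bool fun_eq_iff)
qed

text \<open>
  The form \<open>e\<^sub>i\<^sub>1\<^sup>* \<and> \<cdots> \<and> e\<^sub>i\<^sub>k\<^sup>*\<close>: its value on a list of vectors is the minor of their coordinate matrix in
  the columns \<open>i\<^sub>1, \<dots>, i\<^sub>k\<close>.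
\<close>

definition coordinate_form :: "'n list \<Rightarrow> (real ^ 'n) list \<Rightarrow> complex" where
  "coordinate_form is vs = (if length vs = length is then
     \<Sum>\<pi> | \<pi> permutes {..<length is}.
       of_int (sign \<pi>) * (\<Prod>a<length is. complex_of_real (vs ! a $ (is ! \<pi> a))) else 0)"

text \<open>
  If the entries at positions \<open>i\<close> and \<open>j\<close> agree, composing a permutation with the transposition of
  \<open>i\<close> and \<open>j\<close> preserves its product and flips its sign, so the terms of the minor cancel.
\<close>

lemma coordinate_form_alt_forms: "coordinate_form is \<in> alt_forms (length is)"
  unfolding alt_forms_def
proof (intro CollectI conjI allI impI)
  let ?k = "length is"
  let ?P = "{\<pi>. \<pi> permutes {..<?k}}"
  show "coordinate_form is vs = 0" if "length vs \<noteq> ?k" for vs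
    using that by (simp add: coordinate_form_def)
  show "linear (\<lambda>v. coordinate_form is (vs[i := v]))" if "length vs = ?k" "i < ?k" for vs i
  proof -
    have "coordinate_form is (vs[i := v]) =
        (\<Sum>\<pi>\<in>?P. of_int (sign \<pi>) * (complex_of_real (v $ (is ! \<pi> i)) *
          (\<Prod>a\<in>{..<?k} - {i}. complex_of_real (vs ! a $ (is ! \<pi> a)))))" for v
      using that by (simp add: coordinate_form_def prod.remove[of _ i])
    then show ?thesis
      by (intro linearI) (simp_all add: algebra_simps sum.distrib sum_distrib_left
          scaleR_conv_of_real[where 'a = complex])
  qed
  show "coordinate_form is vs = 0"
    if len: "length vs = ?k" and ij: "i < j" "j < ?k" and eq: "vs ! i = vs ! j" for vs i j
  proof -
    let ?t = "Transposition.transpose i j"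
    let ?T = "\<lambda>\<pi>. of_int (sign \<pi>) * (\<Prod>a<?k. complex_of_real (vs ! a $ (is ! \<pi> a)))"
    have t: "?t permutes {..<?k}"
      using ij by (intro permutes_swap_id) auto
    have "?T (\<pi> \<circ> ?t) = - ?T \<pi>" if "\<pi> \<in> ?P" for \<pi>
    proof -
      have "(\<Prod>a<?k. complex_of_real (vs ! a $ (is ! \<pi> a))) =
          (\<Prod>a<?k. complex_of_real (vs ! ?t a $ (is ! \<pi> (?t a))))"
        using prod.permute[OF t, of "\<lambda>a. complex_of_real (vs ! a $ (is ! \<pi> a))"] by (simp add: o_def)
      also have "\<dots> = (\<Prod>a<?k. complex_of_real (vs ! a $ (is ! \<pi> (?t a))))"
        using eq by (intro prod.cong refl) (auto simp: Transposition.transpose_def)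
      finally have "(\<Prod>a<?k. complex_of_real (vs ! a $ (is ! (\<pi> \<circ> ?t) a))) =
          (\<Prod>a<?k. complex_of_real (vs ! a $ (is ! \<pi> a)))"
        by simp
      moreover have "sign (\<pi> \<circ> ?t) = - sign \<pi>"
        using that ij t by (subst sign_compose) (auto simp: sign_swap_id permutation_permutes)
      ultimately show ?thesis
        by simp
    qed
    then have "(\<Sum>\<pi>\<in>?P. ?T \<pi>) = (\<Sum>\<pi>\<in>?P. - ?T \<pi>)"
      by (subst sum_permutations_compose_right[OF t]) (rule sum.cong[OF refl])
    then have "(\<Sum>\<pi>\<in>?P. ?T \<pi>) = 0"
      by (simp add: sum_negf)
    then show ?thesis
      using len by (simp add: coordinate_form_def)
  qed
qed

lemma coordinate_form_basis:
  fixes "is" js :: "'n::{finite,linorder} list"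
  assumes "sorted_wrt (<) is" "sorted_wrt (<) js" and len: "length js = length is"
  shows "coordinate_form is (map (\<lambda>i. axis i 1) js) = (if is = js then 1 else 0)"
proof -
  let ?k = "length is"
  let ?M = "\<lambda>\<pi>. \<Prod>a<?k. complex_of_real (axis (js ! a) 1 $ (is ! \<pi> a))"
  have dist: "distinct is" "distinct js" "sorted is" "sorted js"
    using assms by (auto simp: strict_sorted_iff)
  \<comment> \<open>a permutation contributes only if it carries \<open>is\<close> to \<open>js\<close>, both of which are increasing\<close>
  have M: "?M \<pi> = (if is = js \<and> \<pi> = id then 1 else 0)" if \<pi>: "\<pi> permutes {..<?k}" for \<pi>
  proof (cases "\<forall>a<?k. is ! \<pi> a = js ! a")
    case True
    have "permute_list \<pi> is = js"
      using True len by (intro nth_equalityI) (auto simp: permute_list_nth[OF \<pi>])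
    then have "mset is = mset js"
      using mset_permute_list[OF \<pi>] by simp
    then have eq: "is = js"
      using dist by (metis properties_for_sort sorted_sort_id)
    have "\<pi> a = a" for a
    proof (cases "a < ?k")
      case a: True
      then have "\<pi> a < ?k"
        using permutes_in_image[OF \<pi>, of a] by simp
      then show ?thesis
        using True a eq dist(1) nth_eq_iff_index_eq by blast
    next
      case False
      then show ?thesis
        using permutes_not_in[OF \<pi>, of a] by simp
    qed
    then have "\<pi> = id"
      by auto
    with eq show ?thesis
      by (simp add: axis_def)
  next
    case False
    then have "?M \<pi> = 0"
      by (intro prod_zero) (auto simp: axis_def)
    moreover have "\<not> (is = js \<and> \<pi> = id)"
      using False by auto
    ultimately show ?thesis
      by simp
  qed
  have "coordinate_form is (map (\<lambda>i. axis i 1) js) = (\<Sum>\<pi> | \<pi> permutes {..<?k}. of_int (sign \<pi>) * ?M \<pi>)"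
    using len by (simp add: coordinate_form_def)
  also have "\<dots> = (\<Sum>\<pi> | \<pi> permutes {..<?k}. if \<pi> = id then (if is = js then 1 else 0) else 0)"
    by (intro sum.cong refl, unfold mem_Collect_eq, subst M) (auto simp: sign_id)
  also have "\<dots> = (if is = js then 1 else 0)"
    by (simp add: finite_permutations permutes_id)
  finally show ?thesis .
qed


section \<open>Smoothness of the source operator\<close>

lemma cl_vec_axis: "cl_vec (axis j 1) = axis {j} 1"
proof -
  have "cl_vec (axis j 1) = (\<Sum>i\<in>UNIV. if i = j then axis {i} 1 else 0)"
    unfolding cl_vec_def by (intro sum.cong refl) (simp add: axis_def vec_eq_iff)
  then show ?thesis
    by simp
qed

lemma cl_vec_expand: "cl_vec v = (\<Sum>j\<in>UNIV. complex_of_real (v $ j) *s cl_vec (axis j 1))"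
  unfolding cl_vec_axis by (rule cl_vec_def)

lemma clifford_repD:
  assumes "clifford_rep \<rho>"
  shows "clinear (\<rho> a)" and "\<rho> (a + b) s = \<rho> a s + \<rho> b s" and "\<rho> (c *s a) s = c *\<^sub>C \<rho> a s"
  using assms by (auto simp: clifford_rep_def)

lemma clifford_rep_sum:
  assumes "clifford_rep \<rho>"
  shows "\<rho> (\<Sum>i\<in>A. a i) s = (\<Sum>i\<in>A. \<rho> (a i) s)"
proof -
  have "\<rho> 0 s = 0"
    using clifford_repD(3)[OF assms, of 0 0 s] by simp
  then show ?thesis
    by (induction A rule: infinite_finite_induct) (simp_all add: clifford_repD(2)[OF assms])
qed

lemma clifford_rep_cl_vec_expand:
  assumes "clifford_rep \<rho>"
  shows "\<rho> (cl_vec v) s = (\<Sum>j\<in>UNIV. complex_of_real (v $ j) *\<^sub>C \<rho> (cl_vec (axis j 1)) s)"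
  by (subst cl_vec_expand) (simp only: clifford_rep_sum[OF assms] clifford_repD(3)[OF assms])

lemma dual_rep_in_dual:
  assumes "clifford_rep \<rho>" "t \<in> dual"
  shows "dual_rep \<rho> v t \<in> dual"
proof -
  have "(\<lambda>s. t (\<rho> (cl_vec v) s)) \<in> dual"
    using assms clinear_compose[OF clifford_repD(1)[OF assms(1)]] by (auto simp: dual_def)
  from dual_scale[OF this, of "- 1"] show ?thesis
    by (simp add: dual_rep_def)
qed

lemma dual_rep_expand:
  assumes "clifford_rep \<rho>" "t \<in> dual"
  shows "dual_rep \<rho> v t = (\<lambda>s. \<Sum>j\<in>UNIV. complex_of_real (v $ j) * dual_rep \<rho> (axis j 1) t s)"
proof
  fix s
  have t: "clinear t"
    using assms(2) by (simp add: dual_def)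
  show "dual_rep \<rho> v t s = (\<Sum>j\<in>UNIV. complex_of_real (v $ j) * dual_rep \<rho> (axis j 1) t s)"
    unfolding dual_rep_def clifford_rep_cl_vec_expand[OF assms(1), of v s]
    by (simp add: clinear_sum[OF t] clinear_scaleC[OF t] scaleC_complex_def sum_negf)
qed

text \<open>
  The algebraic hypotheses shared by all operators. They determine the tensor product only through
  its universal property, and leave the norm on it arbitrary.
\<close>

locale spinor_tensor =
  fixes tens :: "'s::complex_vector \<Rightarrow> ('s \<Rightarrow> complex) \<Rightarrow> 't::{complex_vector,real_normed_vector}"
    and \<rho> :: "complex ^ ('n::{finite,linorder} set) \<Rightarrow> 's \<Rightarrow> 's"
  assumes finite_dim: "finite_dim TYPE('s)"
    and rep: "clifford_rep \<rho>"
    and tensor: "is_tensor_product tens"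
begin

lemma bilinear_tens: "bilinear_dual tens"
  using tensor unfolding is_tensor_product_def by blast

text \<open>
  The universal property makes the tensor product finite-dimensional, so its unspecified norm is
  compatible with every complex linear map, scalar multiplication by \<open>\<i>\<close> included.
\<close>

lemma bounded_linear_clinear:
  fixes f :: "'t \<Rightarrow> 'w::{complex_vector,real_normed_vector}"
  assumes "clinear f"
  shows "bounded_linear f"
proof -
  obtain S :: "'t set" where "finite S" "span S = UNIV"
    by (rule tensor_product_finite_real_span[OF finite_dim tensor])
  then show ?thesis
    by (rule linear_imp_bounded_linear_finite_span) (rule clinear_imp_linear[OF assms])
qed

lemma smooth_clinear:
  fixes f :: "'t \<Rightarrow> 'w::{complex_vector,real_normed_vector}"
  shows "clinear f \<Longrightarrow> F \<in> smooth_maps \<Longrightarrow> (\<lambda>p. f (F p)) \<in> smooth_maps"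
  by (rule smooth_maps_bounded_linear[OF bounded_linear_clinear])

lemma bilinear_rep_left: "bilinear_dual (\<lambda>s t. tens (\<rho> (cl_vec v) s) t)"
  unfolding bilinear_dual_def
  by (intro conjI ballI allI clinear_compose[OF clifford_repD(1)[OF rep] bilinear_dualD(1)[OF bilinear_tens]])
    (simp_all only: bilinear_dualD(2,3)[OF bilinear_tens])

lemma bilinear_rep_right: "bilinear_dual (\<lambda>s t. tens s (dual_rep \<rho> v t))"
proof -
  have add: "dual_rep \<rho> v (\<lambda>w. t w + u w) = (\<lambda>w. dual_rep \<rho> v t w + dual_rep \<rho> v u w)" for t u
    by (simp add: dual_rep_def)
  have scale: "dual_rep \<rho> v (\<lambda>w. c * t w) = (\<lambda>w. c * dual_rep \<rho> v t w)" for c t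
    by (simp add: dual_rep_def)
  show ?thesis
    unfolding bilinear_dual_def add scale
    by (intro conjI ballI allI bilinear_dualD[OF bilinear_tens] dual_rep_in_dual[OF rep])
qed

lemmas clinear_act_left = clinear_tensor_lift[OF finite_dim tensor bilinear_rep_left, folded act_left_def]
  and act_left_tens = tensor_lift_tens[OF finite_dim tensor bilinear_rep_left, folded act_left_def]
  and clinear_act_right = clinear_tensor_lift[OF finite_dim tensor bilinear_rep_right, folded act_right_def]
  and act_right_tens = tensor_lift_tens[OF finite_dim tensor bilinear_rep_right, folded act_right_def]

text \<open>
  The Clifford action of a vector that varies with the point is a combination of fixed endomorphisms
  with the coordinates of that vector as coefficients.
\<close>

lemma act_left_expand:
  "act_left tens \<rho> v w = (\<Sum>j\<in>UNIV. (v $ j) *\<^sub>R act_left tens \<rho> (axis j 1) w)"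
proof -
  have "act_left tens \<rho> v = (\<lambda>w. \<Sum>j\<in>UNIV. complex_of_real (v $ j) *\<^sub>C act_left tens \<rho> (axis j 1) w)"
  proof (rule tensor_lift_unique[OF tensor clinear_act_left])
    show "clinear (\<lambda>w. \<Sum>j\<in>UNIV. complex_of_real (v $ j) *\<^sub>C act_left tens \<rho> (axis j 1) w)"
      by (intro clinear_compose_sum clinear_compose[OF clinear_act_left clinear_scale])
    fix s :: 's and t :: "'s \<Rightarrow> complex"
    assume t: "t \<in> dual"
    note lin = bilinear_dualD(1)[OF bilinear_tens t]
    show "act_left tens \<rho> v (tens s t) =
        (\<Sum>j\<in>UNIV. complex_of_real (v $ j) *\<^sub>C act_left tens \<rho> (axis j 1) (tens s t))"
      unfolding act_left_tens[OF t] clifford_rep_cl_vec_expand[OF rep, of v s]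
      by (simp only: clinear_sum[OF lin] clinear_scaleC[OF lin])
  qed
  then show ?thesis
    by (simp add: scaleC_of_real)
qed

lemma act_right_expand:
  "act_right tens \<rho> v w = (\<Sum>j\<in>UNIV. (v $ j) *\<^sub>R act_right tens \<rho> (axis j 1) w)"
proof -
  have "act_right tens \<rho> v = (\<lambda>w. \<Sum>j\<in>UNIV. complex_of_real (v $ j) *\<^sub>C act_right tens \<rho> (axis j 1) w)"
  proof (rule tensor_lift_unique[OF tensor clinear_act_right])
    show "clinear (\<lambda>w. \<Sum>j\<in>UNIV. complex_of_real (v $ j) *\<^sub>C act_right tens \<rho> (axis j 1) w)"
      by (intro clinear_compose_sum clinear_compose[OF clinear_act_right clinear_scale])
    fix s :: 's and t :: "'s \<Rightarrow> complex"
    assume t: "t \<in> dual"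
    show "act_right tens \<rho> v (tens s t) =
        (\<Sum>j\<in>UNIV. complex_of_real (v $ j) *\<^sub>C act_right tens \<rho> (axis j 1) (tens s t))"
      unfolding act_right_tens[OF t] dual_rep_expand[OF rep t, of v]
      by (rule bilinear_dual_sum_right[OF bilinear_tens dual_rep_in_dual[OF rep t]])
  qed
  then show ?thesis
    by (simp add: scaleC_of_real)
qed

lemma smooth_act_left:
  assumes "\<And>j. (\<lambda>p. v p $ j) \<in> smooth_maps" "F \<in> smooth_maps"
  shows "(\<lambda>p. act_left tens \<rho> (v p) (F p)) \<in> smooth_maps"
proof -
  have "(\<lambda>p. \<Sum>j\<in>UNIV. (v p $ j) *\<^sub>R act_left tens \<rho> (axis j 1) (F p)) \<in> smooth_maps"
    by (rule smooth_maps_sum, rule smooth_maps_scaleR[OF assms(1)])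
      (rule smooth_clinear[OF clinear_act_left assms(2)])
  then show ?thesis
    by (simp only: act_left_expand[symmetric])
qed

lemma smooth_act_right:
  assumes "\<And>j. (\<lambda>p. v p $ j) \<in> smooth_maps" "F \<in> smooth_maps"
  shows "(\<lambda>p. act_right tens \<rho> (v p) (F p)) \<in> smooth_maps"
proof -
  have "(\<lambda>p. \<Sum>j\<in>UNIV. (v p $ j) *\<^sub>R act_right tens \<rho> (axis j 1) (F p)) \<in> smooth_maps"
    by (rule smooth_maps_sum, rule smooth_maps_scaleR[OF assms(1)])
      (rule smooth_clinear[OF clinear_act_right assms(2)])
  then show ?thesis
    by (simp only: act_right_expand[symmetric])
qed

lemma smooth_scaleC:
  fixes F :: "'a::euclidean_space \<Rightarrow> 't"
  shows "F \<in> smooth_maps \<Longrightarrow> (\<lambda>p. c *\<^sub>C F p) \<in> smooth_maps"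
  by (rule smooth_clinear[OF clinear_scale])

end

lemma smooth_dx: "F \<in> smooth_maps \<Longrightarrow> dx j F \<in> smooth_maps"
  using smooth_maps_partial[of F "(axis j 1, 0)"]
  by (auto simp: dx_def[abs_def] Basis_prod_def Basis_vec_def)

lemma smooth_dy: "F \<in> smooth_maps \<Longrightarrow> dy j F \<in> smooth_maps"
  using smooth_maps_partial[of F "(0, axis j 1)"]
  by (auto simp: dy_def[abs_def] Basis_prod_def Basis_vec_def)

lemma smooth_laplace_x: "F \<in> smooth_maps \<Longrightarrow> laplace_x F \<in> smooth_maps"
  unfolding laplace_x_def[abs_def] by (intro smooth_maps_sum smooth_dx)

lemma smooth_laplace_y: "F \<in> smooth_maps \<Longrightarrow> laplace_y F \<in> smooth_maps"
  unfolding laplace_y_def[abs_def] by (intro smooth_maps_sum smooth_dy)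

lemma smooth_coordinate_diff:
  "(\<lambda>p :: (real, 'n::finite) vec \<times> (real, 'n) vec. fst p $ j - snd p $ j) \<in> smooth_maps"
  "(\<lambda>p :: (real, 'n::finite) vec \<times> (real, 'n) vec. snd p $ j - fst p $ j) \<in> smooth_maps"
  by (intro smooth_maps_of_bounded_linear bounded_linear_sub
      bounded_linear_compose[OF bounded_linear_vec_nth bounded_linear_fst]
      bounded_linear_compose[OF bounded_linear_vec_nth bounded_linear_snd])+

lemma smooth_norm_diff_squared:
  "(\<lambda>p :: (real, 'n::finite) vec \<times> (real, 'n) vec. (norm (fst p - snd p))\<^sup>2) \<in> smooth_maps"
proof -
  have "(norm (fst p - snd p))\<^sup>2 = (\<Sum>j\<in>UNIV. (fst p $ j - snd p $ j) *\<^sub>R (fst p $ j - snd p $ j))"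
    for p :: "(real, 'n) vec \<times> (real, 'n) vec"
    by (simp add: power2_norm_eq_inner inner_vec_def)
  then show ?thesis
    by (simp only:) (intro smooth_maps_sum smooth_maps_scaleR smooth_coordinate_diff)
qed

context spinor_tensor
begin

lemma smooth_dirac_x: "F \<in> smooth_maps \<Longrightarrow> dirac_x tens \<rho> F \<in> smooth_maps"
  unfolding dirac_x_def[abs_def]
  by (intro smooth_maps_sum smooth_clinear[OF clinear_act_left] smooth_dx)

lemma smooth_dirac_y: "F \<in> smooth_maps \<Longrightarrow> dirac_y tens \<rho> F \<in> smooth_maps"
  unfolding dirac_y_def[abs_def]
  by (intro smooth_maps_sum smooth_clinear[OF clinear_act_right] smooth_dy)

text \<open>
  Each term is built from iterated partial derivatives by fixed linear endomorphisms and by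
  multiplication with polynomials in the coordinates of \<open>x - y\<close>.
\<close>

lemma smooth_source_op:
  assumes F: "F \<in> smooth_maps"
  shows "source_op tens \<rho> lam mu F \<in> smooth_maps"
proof -
  note smooth_derivs = smooth_dx smooth_dy smooth_laplace_x smooth_laplace_y smooth_dirac_x smooth_dirac_y F
  have left: "(\<lambda>p. act_left tens \<rho> (fst p - snd p) (G p)) \<in> smooth_maps"
    if "G \<in> smooth_maps" for G :: "('n, 't) field2"
    by (rule smooth_act_left[OF _ that]) (simp add: smooth_coordinate_diff)
  have right: "(\<lambda>p. act_right tens \<rho> (snd p - fst p) (G p)) \<in> smooth_maps"
    if "G \<in> smooth_maps" for G :: "('n, 't) field2"
    by (rule smooth_act_right[OF _ that]) (simp add: smooth_coordinate_diff)
  show ?thesis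
    unfolding source_op_def Let_def case_prod_unfold prod.collapse
    by (intro smooth_maps_add smooth_maps_diff smooth_maps_sum smooth_scaleC smooth_maps_scaleR
        smooth_norm_diff_squared smooth_coordinate_diff left right
        smooth_clinear[OF clinear_act_left] smooth_clinear[OF clinear_act_right] smooth_derivs)
qed

lemma smooth_source_iter: "F \<in> smooth_maps \<Longrightarrow> source_iter tens \<rho> lam mu m F \<in> smooth_maps"
  by (induction m) (simp_all add: smooth_source_op)

end


section \<open>The forms obtained on the diagonal\<close>

context spinor_tensor
begin

lemma bilinear_rep_product_pairing:
  "bilinear_dual (\<lambda>s t. t (foldr (\<lambda>i. \<rho> (cl_vec (axis i 1))) is s))"
proof -
  have "clinear (foldr (\<lambda>i. \<rho> (cl_vec (axis i 1))) is)"
    by (induction "is") (simp_all add: clinear_id id_def o_def clinear_compose clifford_repD(1)[OF rep])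
  then show ?thesis
    unfolding bilinear_dual_def by (auto simp: dual_def scaleC_complex_def intro: clinear_compose)
qed

text \<open>
  The functional \<open>s \<otimes> t \<mapsto> (\<rho>(e\<^sub>i\<^sub>1) \<cdots> \<rho>(e\<^sub>i\<^sub>k) s, t)\<close>, a coefficient of \<open>\<Psi>\<^sup>(\<^sup>k\<^sup>)\<close> in the basis of coordinate forms.
\<close>

definition rep_coefficient :: "'n list \<Rightarrow> 't \<Rightarrow> complex" where
  "rep_coefficient is = tensor_lift tens (\<lambda>s t. t (foldr (\<lambda>i. \<rho> (cl_vec (axis i 1))) is s))"

lemma clinear_rep_coefficient: "clinear (rep_coefficient is)"
  unfolding rep_coefficient_def by (rule clinear_tensor_lift[OF finite_dim tensor bilinear_rep_product_pairing])

text \<open>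
  The sum of coordinate forms shows that a form with the prescribed values exists, hence that the
  description defining \<open>\<Psi>\<^sup>(\<^sup>k\<^sup>)\<close> denotes. It also makes visible that \<open>\<Psi>\<^sup>(\<^sup>k\<^sup>)\<close> depends linearly on the
  tensor.
\<close>

lemma Psi_props:
  shows Psi_expand: "Psi tens \<rho> k v vs =
      (\<Sum>is | length is = k \<and> sorted_wrt (<) is. rep_coefficient is v * coordinate_form is vs)"
    and Psi_in_alt_forms: "Psi tens \<rho> k v \<in> alt_forms k"
proof -
  let ?A = "{is :: 'n list. length is = k \<and> sorted_wrt (<) is}"
  let ?\<omega> = "\<lambda>vs. \<Sum>is\<in>?A. rep_coefficient is v * coordinate_form is vs"
  have alt: "?\<omega> \<in> alt_forms k"
    using coordinate_form_alt_forms by (intro alt_forms_sum) auto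
  have fin: "finite ?A"
    by (rule finite_subset[OF _ finite_lists_length_eq[of UNIV k]]) auto
  have val: "?\<omega> (map (\<lambda>i. axis i 1) js) = rep_coefficient js v"
    if "length js = k" "sorted_wrt (<) js" for js
  proof -
    have "?\<omega> (map (\<lambda>i. axis i 1) js) = (\<Sum>is\<in>?A. if is = js then rep_coefficient is v else 0)"
      using that by (intro sum.cong refl) (simp add: coordinate_form_basis)
    then show ?thesis
      using that fin by simp
  qed
  have "Psi tens \<rho> k v = ?\<omega>"
    unfolding Psi_def rep_coefficient_def[symmetric]
  proof (rule the_equality)
    show "?\<omega> \<in> alt_forms k \<and> (\<forall>is. length is = k \<longrightarrow> sorted_wrt (<) is \<longrightarrow>
        ?\<omega> (map (\<lambda>i. axis i 1) is) = rep_coefficient is v)"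
      using alt val by blast
    show "\<omega> = ?\<omega>"
      if "\<omega> \<in> alt_forms k \<and> (\<forall>is. length is = k \<longrightarrow> sorted_wrt (<) is \<longrightarrow>
        \<omega> (map (\<lambda>i. axis i 1) is) = rep_coefficient is v)" for \<omega>
      using that val by (intro alt_forms_eqI[OF _ alt]) auto
  qed
  with alt show "Psi tens \<rho> k v vs = ?\<omega> vs" and "Psi tens \<rho> k v \<in> alt_forms k"
    by simp_all
qed

lemma clinear_Psi: "clinear (\<lambda>v. Psi tens \<rho> k v vs)"
  unfolding Psi_expand
  using clinear_compose_sum[OF clinear_scale_vector[OF clinear_rep_coefficient],
      of "\<lambda>is. is" "\<lambda>is. coordinate_form is vs"]
  by (simp add: scaleC_complex_def)

text \<open>
  For fixed arguments the form depends linearly on the tensor, and \<open>x \<mapsto> F(x, x)\<close> is \<open>F\<close> composed with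
  the linear diagonal embedding.
\<close>

lemma Psi_diag_smooth_forms:
  assumes "F \<in> smooth_maps"
  shows "Psi_diag tens \<rho> k F \<in> smooth_forms k"
proof -
  have "(\<lambda>x. F (x, x)) \<in> smooth_maps"
    using assms by (rule smooth_maps_compose_linear)
      (rule bounded_linear_Pair[OF bounded_linear_ident bounded_linear_ident])
  then have "(\<lambda>x. Psi tens \<rho> k (F (x, x)) vs) \<in> smooth_maps" for vs
    by (rule smooth_clinear[OF clinear_Psi])
  then show ?thesis
    by (simp add: smooth_forms_def Psi_diag_def Psi_in_alt_forms)
qed

end


section \<open>The recurrence\<close>

text \<open>
  The iterate composes with the latest, most shifted factor on the left. Splitting off the first
  factor instead leaves the iterate with both initial parameters raised by one.
\<close>

lemma source_iter_Suc_first: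
  "source_iter tens \<rho> lam mu (Suc m) = source_iter tens \<rho> (lam + 1) (mu + 1) m \<circ> source_op tens \<rho> lam mu"
proof (induction m)
  case (Suc m)
  have "source_iter tens \<rho> lam mu (Suc (Suc m)) =
      source_op tens \<rho> (lam + of_nat (Suc m)) (mu + of_nat (Suc m)) \<circ> source_iter tens \<rho> lam mu (Suc m)"
    by (rule source_iter.simps)
  also have "\<dots> = source_op tens \<rho> (lam + 1 + of_nat m) (mu + 1 + of_nat m) \<circ>
      source_iter tens \<rho> (lam + 1) (mu + 1) m \<circ> source_op tens \<rho> lam mu"
    unfolding Suc.IH by (simp add: o_assoc add.assoc)
  finally show ?case
    by simp
qed simp

theorem proposition5p3:
  fixes tens :: "'s::complex_vector \<Rightarrow> ('s \<Rightarrow> complex) \<Rightarrow> 't::{complex_vector,real_normed_vector}"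
    and \<rho> :: "complex ^ ('n::{finite,linorder} set) \<Rightarrow> 's \<Rightarrow> 's"
    and lam mu :: complex
    and k m :: nat
  assumes "finite_dim TYPE('s)"
    and "clifford_rep \<rho>"
    and "is_tensor_product tens"
    and "k \<le> CARD('n)"
    and "m \<ge> 1"
  shows "bidiff_op tens \<rho> k lam mu m \<in> smooth_maps \<rightarrow> smooth_forms k \<and>
    (\<forall>F\<in>smooth_maps. bidiff_op tens \<rho> k lam mu m F =
      (bidiff_op tens \<rho> k (lam + 1) (mu + 1) (m - 1) \<circ> source_op tens \<rho> lam mu) F)"
proof -
  interpret spinor_tensor tens \<rho>
    using assms by unfold_locales
  obtain m' where m: "m = Suc m'"
    using assms by (cases m) auto
  have "bidiff_op tens \<rho> k lam mu m F \<in> smooth_forms k" if "F \<in> smooth_maps" for F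
    using that by (simp add: bidiff_op_def Psi_diag_smooth_forms smooth_source_iter)
  moreover have "bidiff_op tens \<rho> k lam mu m =
      bidiff_op tens \<rho> k (lam + 1) (mu + 1) (m - 1) \<circ> source_op tens \<rho> lam mu"
    unfolding bidiff_op_def m source_iter_Suc_first by (simp add: o_assoc)
  ultimately show ?thesis
    by simp
qed

end
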